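(* Let $G$ be a finite abelian group of odd order $m$ which is not cyclic. Then $G$ is ordinary, except for the cases $G\cong\mathbb{Z}_p\oplus\mathbb{Z}_p$ with $p$ an odd prime, $3\le p\le 17$. In the exceptional cases with $p\in\{5,7,11,13,17\}$ one has $\hat{l}=l_0+2$ for $p=7,11,13,17$ and $\hat{l}=l_0+4$ for $p=5$.
   Context: For a finite abelian group $G$ of odd order $m$, a Cayley subset is a subset $S\subset G$ with $0\notin S$, $S=-S$, and $S$ generating $G$. The Cayley graph $X(S)$ has vertex set $G$ with $x\sim y$ iff $y-x\in S$; its eigenvalues are $\lambda_\chi=\sum_{a\in S}\chi(a)$ for $\chi$ in the character group $\widehat G$, and $\mu(S)=\max\{|\lambda_\chi|:\chi\neq\mathbf{1}_G\}$. $X(S)$ is Ramanujan if $\mu(S)\le 2\sqrt{|S|-1}$. The covalency is $l(S)=m-|S|$ (odd). $\hat{l}$ is the largest covalency value $l$ such that $X(S)$ is Ramanujan for every Cayley subset $S$ with $l(S)\le l$. Let $l_0=2\lfloor\sqrt{m}-\frac32\rfloor+1$ (one always has $\hat l\ge l_0$). $G$ is ordinary if $\hat{l}=l_0$ and exceptional if $\hat{l}\ge l_0+2$. $\mathbb{Z}_n=\mathbb{Z}/n\mathbb{Z}$. *)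

theory Defs
  imports Complex_Main "HOL-Algebra.Elementary_Groups" "HOL-Computational_Algebra.Primes"
begin

text \<open>
  Groups are written multiplicatively, as in HOL-Algebra: the conditions \<open>0 \<notin> S\<close> and \<open>S = -S\<close>
  become \<open>\<one> \<notin> S\<close> and \<open>S\<close> being equal to its set of inverses.
\<close>

definition cayley_subset :: "('a, 'b) monoid_scheme \<Rightarrow> 'a set \<Rightarrow> bool" where
  "cayley_subset G S \<longleftrightarrow>
     S \<subseteq> carrier G \<and> \<one>\<^bsub>G\<^esub> \<notin> S \<and> S = (\<lambda>x. inv\<^bsub>G\<^esub> x) ` S \<and> generate G S = carrier G"

definition complex_mult_group :: "complex monoid" where
  "complex_mult_group = \<lparr>carrier = UNIV - {0}, monoid.mult = (*), one = 1\<rparr>"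

text \<open>
  Characters are extensional outside the carrier, so that each character of the group is
  represented by exactly one function.
\<close>

definition characters :: "('a, 'b) monoid_scheme \<Rightarrow> ('a \<Rightarrow> complex) set" where
  "characters G = hom G complex_mult_group \<inter> extensional (carrier G)"

definition trivial_character :: "('a, 'b) monoid_scheme \<Rightarrow> 'a \<Rightarrow> complex" where
  "trivial_character G = (\<lambda>x\<in>carrier G. 1)"

definition cayley_eigenvalue :: "'a set \<Rightarrow> ('a \<Rightarrow> complex) \<Rightarrow> complex" where
  "cayley_eigenvalue S \<chi> = (\<Sum>a\<in>S. \<chi> a)"

definition cayley_mu :: "('a, 'b) monoid_scheme \<Rightarrow> 'a set \<Rightarrow> real" where
  "cayley_mu G S =
     Max {cmod (cayley_eigenvalue S \<chi>) | \<chi>. \<chi> \<in> characters G \<and> \<chi> \<noteq> trivial_character G}"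

definition ramanujan :: "('a, 'b) monoid_scheme \<Rightarrow> 'a set \<Rightarrow> bool" where
  "ramanujan G S \<longleftrightarrow> cayley_mu G S \<le> 2 * sqrt (real (card S) - 1)"

definition covalency :: "('a, 'b) monoid_scheme \<Rightarrow> 'a set \<Rightarrow> int" where
  "covalency G S = int (order G) - int (card S)"

text \<open>
  The maximum ranges over values attained as the covalency of some Cayley subset; without
  this restriction the condition could hold for arbitrarily large \<open>l\<close>
  (e.g. for the elementary abelian group of order 9).
\<close>

definition l_hat :: "('a, 'b) monoid_scheme \<Rightarrow> int" where
  "l_hat G =
     Max {l. (\<exists>S. cayley_subset G S \<and> covalency G S = l) \<and>
             (\<forall>S. cayley_subset G S \<and> covalency G S \<le> l \<longrightarrow> ramanujan G S)}"

definition l_zero :: "('a, 'b) monoid_scheme \<Rightarrow> int" where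
  "l_zero G = 2 * \<lfloor>sqrt (real (order G)) - 3 / 2\<rfloor> + 1"

definition ordinary :: "('a, 'b) monoid_scheme \<Rightarrow> bool" where
  "ordinary G \<longleftrightarrow> l_hat G = l_zero G"

definition exceptional :: "('a, 'b) monoid_scheme \<Rightarrow> bool" where
  "exceptional G \<longleftrightarrow> l_hat G \<ge> l_zero G + 2"

end

theory Submission
  imports "HOL-Analysis.Complex_Transcendental" "HOL-Algebra.Multiplicative_Group" "HOL-Algebra.Sylow" Defs
begin

text \<open>
  Write a Cayley subset as \<open>S = G - T\<close>. Since a nontrivial character \<open>\<psi>\<close> sums to zero over \<open>G\<close>, the eigenvalue
  of \<open>S\<close> at \<open>\<psi>\<close> is minus the sum of \<open>\<psi>\<close> over \<open>T\<close>, of absolute value at most \<open>l = card T\<close>, and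
  \<open>l \<le> 2 * sqrt (m - l - 1)\<close> holds iff \<open>(l + 2)\<^sup>2 \<le> 4 * m\<close>, that is, iff \<open>l \<le> l\<^sub>0\<close> for odd \<open>l\<close>. So \<open>G\<close> is ordinary as
  soon as some nontrivial character has a kernel with at least \<open>l\<^sub>0 + 2\<close> elements. For every prime \<open>q\<close>
  dividing \<open>m\<close> there is a character with kernel of order \<open>m / q\<close>. A noncyclic group has \<open>m = p\<^sup>2 * k\<close>, and
  the kernel is large enough with \<open>q = p\<close> if \<open>k \<ge> 5\<close> and with \<open>q = 3\<close> if \<open>k = 3\<close>.

  There remains the elementary abelian group of order \<open>p\<^sup>2\<close>, where \<open>l\<^sub>0 = 2 * p - 3\<close>. Nontrivial characters take
  \<open>p\<close>-th roots of unity as values and have kernel of order \<open>p\<close>, so the largest character sum over a symmetric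
  \<open>T\<close> with \<open>l\<close> elements fills the kernel and distributes the remaining elements over the two cosets
  with values \<open>cis (\<plusminus> 2 * pi / p)\<close>; it equals \<open>p + (l - p) * cos (2 * pi / p)\<close> (negative sums never
  exceed the bound first). Comparing this with
  \<open>2 * sqrt (p\<^sup>2 - l - 1)\<close> for \<open>l = 2 * p - 1\<close> and \<open>l = 2 * p + 1\<close> (and \<open>l = 13\<close> for \<open>p = 5\<close>) decides all cases.
\<close>

section \<open>Finite abelian groups\<close>

text \<open>The exponents \<open>i\<close> with \<open>x [^] i \<in> H\<close> form an ideal of the
  integers containing the prime \<open>p\<close> but not 1, hence the ideal generated by
  \<open>p\<close>. This provides coordinates modulo \<open>p\<close>, both for the isomorphism with
  a product of two groups of order \<open>p\<close> and for building characters.\<close>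

lemma (in group) int_pow_mem_subgroup_iff:
  fixes i :: int
  assumes H: "subgroup H G" and x: "x \<in> carrier G" "x \<notin> H" and p: "prime p" "x [^] (p::nat) \<in> H"
  shows "x [^] i \<in> H \<longleftrightarrow> int p dvd i"
proof
  assume "int p dvd i"
  then obtain k where "i = int p * k" by blast
  then have "x [^] i = (x [^] p) [^] k"
    using x by (simp add: int_pow_pow flip: int_pow_int)
  then show "x [^] i \<in> H"
    using subgroup_int_pow_closed[OF H p(2)] by simp
next
  assume i: "x [^] i \<in> H"
  show "int p dvd i"
  proof (rule ccontr)
    assume "\<not> int p dvd i"
    then have "coprime (int p) i"
      using p(1) prime_imp_coprime[of "int p" i] by simp
    then obtain u v where uv: "u * int p + v * i = 1"
      using bezout_int[of "int p" i] by auto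
    have "x = x [^] (u * int p + v * i)"
      using x uv by simp
    also have "\<dots> = (x [^] p) [^] u \<otimes> (x [^] i) [^] v"
      using x by (simp add: int_pow_mult int_pow_pow mult.commute flip: int_pow_int)
    also have "\<dots> \<in> H"
      using subgroup.m_closed[OF H subgroup_int_pow_closed[OF H p(2)] subgroup_int_pow_closed[OF H i]] by simp
    finally show False using x by simp
  qed
qed

text \<open>Cauchy's theorem: Sylow's theorem applied with exponent 1 yields a subgroup of order
  \<open>p\<close>, in which every nontrivial element has order \<open>p\<close>.\<close>

lemma (in group) exists_ord_eq_prime:
  assumes "finite (carrier G)" "prime p" "p dvd order G"
  obtains x where "x \<in> carrier G" "ord x = p"
proof -
  obtain m where "order G = p ^ 1 * m" using assms(3) by auto
  from sylow_thm[OF assms(2) is_group this assms(1)]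
  obtain H where H: "subgroup H G" "card H = p" by auto
  have "p \<noteq> 1" using assms(2) by auto
  then have "H \<noteq> {\<one>}" using H by auto
  then obtain x where x: "x \<in> H" "x \<noteq> \<one>"
    using subgroup.one_closed[OF H(1)] by blast
  have xc: "x \<in> carrier G" using x H subgroup.subset by blast
  interpret GH: group "G\<lparr>carrier := H\<rparr>"
    using H(1) by (rule subgroup.subgroup_is_group) (rule is_group)
  have "x [^]\<^bsub>G\<lparr>carrier := H\<rparr>\<^esub> order (G\<lparr>carrier := H\<rparr>) = \<one>\<^bsub>G\<lparr>carrier := H\<rparr>\<^esub>"
    using x by (intro GH.pow_order_eq_1) auto
  then have "x [^] p = \<one>"
    using H(2) nat_pow_consistent[of x p H] by (simp add: order_def)
  then have "ord x dvd p" using xc by (simp add: pow_eq_id)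
  moreover have "ord x \<noteq> 1" using x xc ord_eq_1 by blast
  ultimately have "ord x = p" using assms(2) by (auto simp: prime_nat_iff)
  with xc show thesis by (rule that)
qed

lemma (in comm_group) ord_mult_coprime:
  assumes x: "x \<in> carrier G" and y: "y \<in> carrier G" and c: "coprime (ord x) (ord y)"
  shows "ord (x \<otimes> y) = ord x * ord y"
proof (rule dvd_antisym)
  show "ord (x \<otimes> y) dvd ord x * ord y" using x y by (rule abelian_ord_mul_divides)
  have *: "ord u dvd ord (u \<otimes> v)" if u: "u \<in> carrier G" and v: "v \<in> carrier G"
    and c: "coprime (ord u) (ord v)" for u v
  proof -
    \<comment> \<open>This exponent kills both the product and \<open>v\<close>, hence also
      \<open>u\<close>; coprimality then removes the factor \<open>ord v\<close>.\<close>
    let ?n = "ord (u \<otimes> v) * ord v"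
    have "(u \<otimes> v) [^] ?n = \<one>"
      using u v by (subst pow_eq_id) auto
    then have "\<one> = (u \<otimes> v) [^] ?n" ..
    also have "\<dots> = u [^] ?n \<otimes> v [^] ?n" using u v by (simp add: nat_pow_distrib)
    also have "v [^] ?n = \<one>" using v by (subst pow_eq_id) auto
    finally have "u [^] ?n = \<one>" using u v by simp
    then have "ord u dvd ?n" using u by (simp add: pow_eq_id)
    then show ?thesis using c by (simp add: coprime_dvd_mult_left_iff)
  qed
  have "ord x dvd ord (x \<otimes> y)" "ord y dvd ord (x \<otimes> y)"
    using *[OF x y c] *[OF y x] c x y by (simp_all add: coprime_commute m_comm)
  then show "ord x * ord y dvd ord (x \<otimes> y)"
    using c by (simp add: divides_mult)
qed

lemma (in group) cyclic_group_if_ord_eq_order: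
  assumes "finite (carrier G)" "x \<in> carrier G" "ord x = order G"
  shows "cyclic_group G"
proof -
  have "generate G {x} \<subseteq> carrier G" using assms by (intro generate_incl) auto
  moreover have "card (generate G {x}) = card (carrier G)"
    using assms generate_pow_card by (simp add: order_def)
  ultimately have "generate G {x} = carrier G"
    using assms(1) by (intro card_subset_eq)
  then have "carrier G = range (\<lambda>n::int. x [^] n)"
    using generate_pow[OF assms(2)] by (auto simp: image_def)
  with assms(2) show ?thesis by (intro iffD2[OF cyclic_group] bexI[of _ x])
qed

text \<open>If \<open>x\<close> has maximal order \<open>n\<close> and \<open>p\<close> divides \<open>m div n\<close> but not \<open>n\<close>, then multiplying \<open>x\<close> by an element
  of order \<open>p\<close> would increase the order.\<close>

lemma (in comm_group) not_cyclic_imp_prime_square_dvd: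
  assumes fin: "finite (carrier G)" and nc: "\<not> cyclic_group G"
  obtains p where "prime p" "p\<^sup>2 dvd order G"
proof -
  have ne: "ord ` carrier G \<noteq> {}" by auto
  obtain x where x: "x \<in> carrier G" and xmax: "ord x = Max (ord ` carrier G)"
    using Max_in[of "ord ` carrier G"] fin ne by (metis finite_imageI imageE)
  have max: "ord y \<le> ord x" if "y \<in> carrier G" for y
    using that fin xmax by simp
  obtain k where k: "order G = ord x * k"
    using ord_dvd_group_order[OF x] by blast
  have "k \<noteq> 1" using cyclic_group_if_ord_eq_order[OF fin x] nc k by auto
  then obtain p where p: "prime p" "p dvd k" using prime_factor_nat by blast
  have pord: "p dvd order G" using p k by auto
  have "p dvd ord x"
  proof (rule ccontr)
    assume np: "\<not> p dvd ord x"
    obtain y where y: "y \<in> carrier G" "ord y = p"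
      using exists_ord_eq_prime[OF fin p(1) pord] by blast
    have "coprime (ord x) (ord y)"
      using np p(1) y(2) prime_imp_coprime coprime_commute by metis
    then have "ord (x \<otimes> y) = ord x * p"
      using ord_mult_coprime[OF x y(1)] y(2) by simp
    then have "ord x * p \<le> ord x"
      using max[of "x \<otimes> y"] x y by simp
    moreover have "ord x > 0" using ord_ge_1[OF fin x] by simp
    ultimately show False using prime_gt_1_nat[OF p(1)] by simp
  qed
  then have "p\<^sup>2 dvd order G" using p k by (simp add: power2_eq_square mult_dvd_mono)
  with p(1) show thesis by (rule that)
qed

section \<open>Noncyclic groups of order \<open>p\<^sup>2\<close>\<close>

lemma (in group) pow_prime_eq_one_if_order_square:
  assumes fin: "finite (carrier G)" and nc: "\<not> cyclic_group G"
    and p: "prime p" "order G = p\<^sup>2" and x: "x \<in> carrier G"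
  shows "x [^] p = \<one>"
proof -
  have "ord x dvd p ^ 2" using ord_dvd_group_order[OF x] p by simp
  then obtain i where i: "i \<le> 2" "ord x = p ^ i"
    using divides_primepow_nat[OF p(1)] by blast
  have "i \<noteq> 2" using cyclic_group_if_ord_eq_order[OF fin x] nc i p(2) by auto
  then have "i \<le> 1" using i(1) by simp
  then have "ord x dvd p" using i(2) le_imp_power_dvd[of i 1 p] by simp
  then show ?thesis using x by (simp add: pow_eq_id)
qed

text \<open>A nontrivial \<open>x\<close> and a \<open>y\<close> outside the cyclic group
  \<open>A\<close> of \<open>x\<close> serve as a basis. Two representations of one element put a
  power of \<open>y\<close> into \<open>A\<close>, so the \<open>y\<close>-exponents agree modulo
  \<open>p\<close>, and then so do the \<open>x\<close>-exponents. Counting turns injectivity into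
  bijectivity.\<close>

lemma (in comm_group) iso_prime_square:
  assumes fin: "finite (carrier G)" and nc: "\<not> cyclic_group G"
    and p: "prime p" "order G = p\<^sup>2"
  shows "G \<cong> integer_mod_group p \<times>\<times> integer_mod_group p"
proof -
  have p1: "p > 1" using p prime_gt_1_nat by blast
  have pw: "x [^] p = \<one>" if "x \<in> carrier G" for x
    using pow_prime_eq_one_if_order_square[OF fin nc p that] .
  have "card (carrier G) \<noteq> 1" using p p1 by (auto simp: order_def)
  then obtain x where x: "x \<in> carrier G" "x \<noteq> \<one>"
    by (metis is_singletonI' is_singleton_altdef one_closed empty_iff)
  define A where "A = range (\<lambda>n::int. x [^] n)"
  have A: "subgroup A G" unfolding A_def by (rule subgroup_of_powers[OF x(1)])
  have "A \<noteq> carrier G" using nc x(1) unfolding A_def cyclic_group by blast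
  then obtain y where y: "y \<in> carrier G" "y \<notin> A"
    using subgroup.subset[OF A] by blast
  let ?Z = "integer_mod_group p"
  let ?f = "\<lambda>(i::int, j::int). x [^] i \<otimes> y [^] j"
  have xi: "x [^] i = \<one> \<longleftrightarrow> int p dvd i" for i :: int
    using int_pow_mem_subgroup_iff[OF triv_subgroup x(1) _ p(1)] x pw by simp
  have yj: "y [^] j \<in> A \<longleftrightarrow> int p dvd j" for j :: int
    using int_pow_mem_subgroup_iff[OF A y p(1)] pw[OF y(1)] subgroup.one_closed[OF A] by simp
  have yj1: "y [^] j = \<one>" if "int p dvd j" for j :: int
    using that pw[OF y(1)] y(1) by (auto simp: int_pow_int simp flip: int_pow_pow)
  \<comment> \<open>Addition in \<open>integer_mod_group p\<close> reduces modulo \<open>p\<close>,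
    so the homomorphism property needs powers to depend only on the exponent modulo
    \<open>p\<close>.\<close>
  have modpow: "z [^] (k mod int p) = z [^] k" if "z \<in> carrier G" for z and k :: int
  proof -
    have "int (ord z) dvd int p" using pw[OF that] that by (simp add: pow_eq_id)
    moreover have "int p dvd k - k mod int p" by (rule dvd_minus_mod)
    ultimately have "int (ord z) dvd k - k mod int p" by (rule dvd_trans)
    then show ?thesis using int_pow_eq[OF that] by simp
  qed
  have car: "carrier (?Z \<times>\<times> ?Z) = {0..<int p} \<times> {0..<int p}"
    using p1 by (simp add: carrier_integer_mod_group)
  have hom: "?f \<in> hom (?Z \<times>\<times> ?Z) G"
  proof (rule homI)
    fix u assume "u \<in> carrier (?Z \<times>\<times> ?Z)"
    then show "?f u \<in> carrier G" using x y by (auto split: prod.splits)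
  next
    fix u v assume "u \<in> carrier (?Z \<times>\<times> ?Z)" "v \<in> carrier (?Z \<times>\<times> ?Z)"
    obtain i j k l where [simp]: "u = (i, j)" "v = (k, l)" by (cases u, cases v)
    show "?f (u \<otimes>\<^bsub>?Z \<times>\<times> ?Z\<^esub> v) = ?f u \<otimes> ?f v"
      using x y by (simp add: modpow int_pow_mult m_ac)
  qed
  have inj: "inj_on ?f (carrier (?Z \<times>\<times> ?Z))"
  proof (rule inj_onI)
    fix u v assume uv: "u \<in> carrier (?Z \<times>\<times> ?Z)" "v \<in> carrier (?Z \<times>\<times> ?Z)" and eq: "?f u = ?f v"
    obtain i j k l where [simp]: "u = (i, j)" "v = (k, l)" by (cases u, cases v)
    have "y [^] (j - l) = x [^] (k - i)"
    proof -
      have "y [^] (j - l) = x [^] (-i) \<otimes> (x [^] i \<otimes> y [^] j) \<otimes> y [^] (-l)"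
        using x y by (simp add: int_pow_diff int_pow_neg m_assoc[symmetric])
      also have "\<dots> = x [^] (-i) \<otimes> (x [^] k \<otimes> y [^] l) \<otimes> y [^] (-l)"
        using eq by simp
      also have "\<dots> = x [^] (-i) \<otimes> x [^] k \<otimes> (y [^] l \<otimes> y [^] (-l))"
        using x y by (simp add: m_assoc)
      also have "\<dots> = x [^] (k - i)"
        using x y by (simp add: int_pow_mult[symmetric])
      finally show ?thesis .
    qed
    then have *: "y [^] (j - l) \<in> A" by (auto simp: A_def)
    then have d1: "int p dvd j - l" using yj by blast
    then have "x [^] (k - i) = \<one>"
      using yj1 \<open>y [^] (j - l) = x [^] (k - i)\<close> by metis
    then have "int p dvd k - i" using xi by blast
    with d1 show "u = v"
      using uv unfolding car
      by (auto simp: mod_eq_dvd_iff[symmetric])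
  qed
  have sub: "?f ` carrier (?Z \<times>\<times> ?Z) \<subseteq> carrier G"
    using x y by auto
  have "card (?f ` carrier (?Z \<times>\<times> ?Z)) = card (carrier G)"
    using card_image[OF inj] p(2) unfolding car by (simp add: order_def power2_eq_square card_cartesian_product)
  then have "?f ` carrier (?Z \<times>\<times> ?Z) = carrier G"
    using fin sub by (intro card_subset_eq)
  then have "?f \<in> iso (?Z \<times>\<times> ?Z) G"
    using hom inj by (simp add: iso_def bij_betw_def)
  then have "?Z \<times>\<times> ?Z \<cong> G" unfolding is_iso_def by blast
  then show ?thesis
    by (rule group.iso_sym[OF DirProd_group[OF group_integer_mod_group group_integer_mod_group]])
qed

lemma order_eq_if_iso_prime_square:
  assumes "G \<cong> integer_mod_group p \<times>\<times> integer_mod_group p" "p > 0"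
  shows "order G = p\<^sup>2"
  using iso_same_card[OF assms(1)] assms(2)
  by (simp add: order_def carrier_integer_mod_group card_cartesian_product power2_eq_square)

section \<open>Characters\<close>

lemma charactersD:
  assumes "\<psi> \<in> characters G"
  shows character_mult: "\<And>x y. x \<in> carrier G \<Longrightarrow> y \<in> carrier G \<Longrightarrow> \<psi> (x \<otimes>\<^bsub>G\<^esub> y) = \<psi> x * \<psi> y"
    and character_nonzero: "\<And>x. x \<in> carrier G \<Longrightarrow> \<psi> x \<noteq> 0"
  using assms by (auto simp: characters_def complex_mult_group_def hom_def)

lemma (in group) character_one:
  assumes "\<psi> \<in> characters G"
  shows "\<psi> \<one> = 1"
  using character_mult[OF assms one_closed one_closed] character_nonzero[OF assms one_closed] by simp

lemma (in group) character_pow: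
  assumes "\<psi> \<in> characters G" "x \<in> carrier G"
  shows "\<psi> (x [^] (n::nat)) = \<psi> x ^ n"
  by (induction n) (simp_all add: character_one character_mult assms)

lemma (in group) character_power_order:
  assumes "\<psi> \<in> characters G" "x \<in> carrier G"
  shows "\<psi> x ^ order G = 1"
  using character_pow[OF assms, of "order G"] pow_order_eq_1[OF assms(2)] character_one[OF assms(1)] by simp

lemma (in group) norm_character:
  assumes "finite (carrier G)" "\<psi> \<in> characters G" "x \<in> carrier G"
  shows "cmod (\<psi> x) = 1"
proof -
  have "cmod (\<psi> x) ^ order G = 1"
    using character_power_order[OF assms(2,3)] by (metis norm_one norm_power)
  moreover have "order G > 0" using assms(1) by (simp add: order_gt_0_iff_finite)
  ultimately show ?thesis
    using power_eq_imp_eq_base[of "cmod (\<psi> x)" "order G" 1] by simp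
qed

lemma (in group) character_inv:
  assumes "finite (carrier G)" "\<psi> \<in> characters G" "x \<in> carrier G"
  shows "\<psi> (inv x) = cnj (\<psi> x)"
proof -
  have "\<psi> x * \<psi> (inv x) = 1"
    using character_mult[OF assms(2,3), of "inv x"] assms character_one[OF assms(2)] by simp
  moreover have "\<psi> x * cnj (\<psi> x) = 1"
    using norm_character[OF assms] by (simp flip: complex_norm_square)
  ultimately show ?thesis
    using character_nonzero[OF assms(2,3)] by (metis mult_left_cancel)
qed

text \<open>By extensionality a character is determined by its values on the carrier, and these lie
  in the finite set of roots of unity of exponent \<open>order G\<close>.\<close>

lemma (in group) finite_characters:
  assumes "finite (carrier G)"
  shows "finite (characters G)"
proof (rule finite_subset)
  show "characters G \<subseteq> (\<Pi>\<^sub>E x\<in>carrier G. {z. z ^ order G = 1})"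
    using character_power_order by (auto simp: PiE_def characters_def)
  show "finite (\<Pi>\<^sub>E x\<in>carrier G. {z::complex. z ^ order G = 1})"
    using assms order_gt_0_iff_finite by (intro finite_PiE finite_roots_unity) auto
qed

lemma (in group) character_nontrivial:
  assumes "\<psi> \<in> characters G" "\<psi> \<noteq> trivial_character G"
  obtains x where "x \<in> carrier G" "\<psi> x \<noteq> 1"
proof -
  have "\<psi> = trivial_character G" if "\<forall>x\<in>carrier G. \<psi> x = 1"
    using that assms(1) by (auto simp: trivial_character_def characters_def extensional_def restrict_def)
  then show thesis using assms that by blast
qed

lemma (in group) sum_character_eq_0:
  assumes "finite (carrier G)" "\<psi> \<in> characters G" "\<psi> \<noteq> trivial_character G"
  shows "(\<Sum>x\<in>carrier G. \<psi> x) = 0"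
proof -
  obtain a where a: "a \<in> carrier G" "\<psi> a \<noteq> 1" using character_nontrivial assms by blast
  \<comment> \<open>Translation by \<open>a\<close> permutes the carrier and multiplies the sum by
    \<open>\<psi> a \<noteq> 1\<close>.\<close>
  have "(\<Sum>x\<in>carrier G. \<psi> x) = (\<Sum>x\<in>carrier G. \<psi> (a \<otimes> x))"
  proof (rule sum.reindex_bij_witness[of _ "\<lambda>x. a \<otimes> x" "\<lambda>x. inv a \<otimes> x"])
  qed (use a in \<open>auto simp: m_assoc[symmetric]\<close>)
  also have "\<dots> = \<psi> a * (\<Sum>x\<in>carrier G. \<psi> x)"
    using a assms by (simp add: character_mult sum_distrib_left)
  finally show ?thesis using a by simp
qed

lemma (in group) subgroup_character_kernel:
  assumes "finite (carrier G)" "\<psi> \<in> characters G"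
  shows "subgroup {x \<in> carrier G. \<psi> x = 1} G"
  by (rule subgroupI) (use assms in \<open>auto simp: character_mult character_inv character_one intro!: exI[of _ \<one>]\<close>)

section \<open>Construction of characters of prime order\<close>

lemma cis_2pi_of_int_div_eq_1_iff:
  fixes i :: int
  assumes "p > 0"
  shows "cis (2 * pi * of_int i / real p) = 1 \<longleftrightarrow> int p dvd i"
proof
  assume "cis (2 * pi * of_int i / real p) = 1"
  then have "cos (2 * pi * of_int i / real p) = 1" by (metis cis.sel(1) one_complex.sel(1))
  then obtain n :: int where "2 * pi * of_int i / real p = of_int n * 2 * pi"
    using cos_one_2pi_int by blast
  then have "real_of_int i = of_int (n * int p)" using assms by (simp add: field_simps)
  then have "i = n * int p" by (simp only: of_int_eq_iff)
  then show "int p dvd i" by simp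
next
  assume "int p dvd i"
  then obtain n where n: "i = int p * n" by blast
  have "2 * pi * of_int i / real p = 2 * pi * of_int n"
    using assms by (simp add: n)
  then show "cis (2 * pi * of_int i / real p) = 1"
    by (simp add: complex_eq_iff)
qed

lemma cis_2pi_of_int_div_cong:
  fixes i j :: int
  assumes "p > 0" "int p dvd i - j"
  shows "cis (2 * pi * of_int i / real p) = cis (2 * pi * of_int j / real p)"
proof -
  have "cis (2 * pi * of_int i / real p) = cis (2 * pi * of_int (i - j) / real p) * cis (2 * pi * of_int j / real p)"
    using assms by (simp add: cis_mult field_simps)
  then show ?thesis using assms cis_2pi_of_int_div_eq_1_iff[of p "i - j"] by simp
qed

text \<open>A proper subgroup that is maximal among those containing all \<open>p\<close>-th powers has index \<open>p\<close>.\<close>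

lemma (in comm_group) exists_subgroup_prime_index:
  assumes fin: "finite (carrier G)" and p: "prime p" "p dvd order G"
  obtains H x where "subgroup H G" "x \<in> carrier G" "x \<notin> H" "x [^] p \<in> H"
    "\<And>g. g \<in> carrier G \<Longrightarrow> \<exists>h\<in>H. \<exists>i::int. g = h \<otimes> x [^] i"
proof -
  define P where "P = (\<lambda>x. x [^] p) ` carrier G"
  have P: "subgroup P G"
  proof (rule subgroupI)
    show "P \<noteq> {}" "P \<subseteq> carrier G" by (auto simp: P_def)
    show "inv a \<in> P" if "a \<in> P" for a
      using that by (auto simp: P_def simp flip: nat_pow_inv)
    show "a \<otimes> b \<in> P" if "a \<in> P" "b \<in> P" for a b
      using that by (auto simp: P_def simp flip: nat_pow_distrib)
  qed
  \<comment> \<open>A surjective \<open>p\<close>-th power map on a finite group would be injective,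
    contradicting the existence of an element of order \<open>p\<close>.\<close>
  have "P \<noteq> carrier G"
  proof
    assume "P = carrier G"
    then have "inj_on (\<lambda>x. x [^] p) (carrier G)"
      using fin by (intro eq_card_imp_inj_on) (auto simp: P_def)
    moreover obtain y where y: "y \<in> carrier G" "ord y = p"
      using exists_ord_eq_prime[OF fin p] by blast
    moreover have "y [^] p = \<one> [^] p" using y by (metis nat_pow_one pow_ord_eq_1)
    ultimately have "y = \<one>" using inj_onD[of "\<lambda>x. x [^] p" "carrier G" y \<one>] by simp
    then show False using y p by auto
  qed
  define F where "F = {H. subgroup H G \<and> P \<subseteq> H \<and> H \<noteq> carrier G}"
  have "finite F" unfolding F_def
    by (rule finite_subset[of _ "Pow (carrier G)"]) (use fin in \<open>auto dest: subgroup.subset\<close>)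
  moreover have "P \<in> F" using P \<open>P \<noteq> carrier G\<close> by (simp add: F_def)
  ultimately obtain H where H: "H \<in> F" and max: "\<And>K. K \<in> F \<Longrightarrow> H \<subseteq> K \<Longrightarrow> H = K"
    using finite_has_maximal[of F] by blast
  have sH: "subgroup H G" and PH: "P \<subseteq> H" using H by (auto simp: F_def)
  obtain x where x: "x \<in> carrier G" "x \<notin> H"
    using H subgroup.subset[OF sH] by (auto simp: F_def)
  have xp: "x [^] p \<in> H" using x PH by (auto simp: P_def)
  define A where "A = range (\<lambda>n::int. x [^] n)"
  have A: "subgroup A G" unfolding A_def by (rule subgroup_of_powers[OF x(1)])
  have sHA: "subgroup (H <#> A) G" by (rule mult_subgroups[OF sH A])
  have HHA: "H \<subseteq> H <#> A"
    using subgroup.subset[OF sH] subgroup.one_closed[OF A] by (force simp: set_mult_def)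
  have "\<one> \<otimes> x [^] (1::int) \<in> H <#> A"
    using subgroup.one_closed[OF sH] unfolding set_mult_def A_def by blast
  then have "x \<in> H <#> A" using x by simp
  \<comment> \<open>\<open>H <#> A\<close> is a subgroup containing \<open>H\<close> and the new
    element \<open>x\<close>, so maximality of \<open>H\<close> leaves only the whole group.\<close>
  have "H <#> A = carrier G"
  proof (rule ccontr)
    assume "H <#> A \<noteq> carrier G"
    then have "H <#> A \<in> F" using sHA HHA PH by (auto simp: F_def)
    then show False using max[OF _ HHA] x \<open>x \<in> H <#> A\<close> by blast
  qed
  then have "\<exists>h\<in>H. \<exists>i::int. g = h \<otimes> x [^] i" if "g \<in> carrier G" for g
    using that by (force simp: set_mult_def A_def)
  with sH x xp show thesis by (rule that)
qed

text \<open>Every element is \<open>h \<otimes> x [^] i\<close> with \<open>h \<in> H\<close> and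
  \<open>i\<close> unique modulo \<open>p\<close>, so sending it to the \<open>i\<close>-th power of
  \<open>cis (2 * pi / p)\<close> is well defined and multiplicative, with kernel \<open>H\<close>.
  The witness \<open>a\<close> is \<open>x\<close>.\<close>

lemma (in comm_group) exists_character_prime_order:
  assumes fin: "finite (carrier G)" and p: "prime p" "p dvd order G"
  obtains \<psi> a where "\<psi> \<in> characters G" "a \<in> carrier G" "\<psi> a = cis (2 * pi / real p)"
    "p * card {x \<in> carrier G. \<psi> x = 1} = order G"
proof -
  have p0: "p > 0" using p(1) prime_gt_0_nat by blast
  obtain H x where H: "subgroup H G" and x: "x \<in> carrier G" "x \<notin> H" "x [^] p \<in> H"
    and dec: "\<And>g. g \<in> carrier G \<Longrightarrow> \<exists>h\<in>H. \<exists>i::int. g = h \<otimes> x [^] i"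
    using exists_subgroup_prime_index[OF assms] by blast
  have Hc: "h \<in> carrier G" if "h \<in> H" for h using that subgroup.subset[OF H] by blast
  have mem: "x [^] i \<in> H \<longleftrightarrow> int p dvd i" for i :: int
    by (rule int_pow_mem_subgroup_iff[OF H x(1,2) p(1) x(3)])
  have uniq: "int p dvd i - j" if "h \<in> H" "h' \<in> H" "h \<otimes> x [^] i = h' \<otimes> x [^] j" for h h' and i j :: int
  proof -
    have "x [^] (i - j) = inv h \<otimes> (h \<otimes> x [^] i) \<otimes> inv (x [^] j)"
      using that(1,2) x Hc by (simp add: int_pow_diff m_assoc[symmetric])
    also have "\<dots> = inv h \<otimes> h'"
      using that x Hc by (simp add: m_assoc)
    also have "\<dots> \<in> H" using that H by (simp add: subgroup.m_closed subgroup.m_inv_closed)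
    finally show ?thesis using mem by blast
  qed
  \<comment> \<open>An arbitrary choice of exponent suffices: two choices differ by a multiple of
    \<open>p\<close>, which leaves the value of \<open>cis\<close> unchanged.\<close>
  define e :: "'a \<Rightarrow> int" where "e g = (SOME i. \<exists>h\<in>H. g = h \<otimes> x [^] i)" for g
  define \<psi> where "\<psi> = (\<lambda>g\<in>carrier G. cis (2 * pi * of_int (e g) / real p))"
  have chi: "\<psi> (h \<otimes> x [^] i) = cis (2 * pi * of_int i / real p)" if h: "h \<in> H" for h and i :: int
  proof -
    let ?g = "h \<otimes> x [^] i"
    have "\<exists>h\<in>H. ?g = h \<otimes> x [^] (e ?g)"
      unfolding e_def by (rule someI[of "\<lambda>i. \<exists>h\<in>H. ?g = h \<otimes> x [^] i" i]) (use h in blast)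
    then have "int p dvd e ?g - i" using uniq h by metis
    then show ?thesis
      using x Hc[OF h] cis_2pi_of_int_div_cong[OF p0] by (simp add: \<psi>_def)
  qed
  have "\<psi> \<in> hom G complex_mult_group"
  proof (rule homI)
    fix g g' assume g: "g \<in> carrier G" "g' \<in> carrier G"
    obtain h i h' i' where d: "h \<in> H" "g = h \<otimes> x [^] (i::int)" "h' \<in> H" "g' = h' \<otimes> x [^] (i'::int)"
      using dec g by meson
    have "g \<otimes> g' = (h \<otimes> h') \<otimes> x [^] (i + i')"
      using d Hc x by (simp add: int_pow_mult m_ac)
    moreover have "h \<otimes> h' \<in> H" using d H by (simp add: subgroup.m_closed)
    ultimately have "\<psi> (g \<otimes> g') = cis (2 * pi * of_int (i + i') / real p)"
      using chi by simp
    then show "\<psi> (g \<otimes> g') = \<psi> g \<otimes>\<^bsub>complex_mult_group\<^esub> \<psi> g'"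
      using d chi by (simp add: complex_mult_group_def cis_mult field_simps add_divide_distrib)
  qed (simp add: complex_mult_group_def \<psi>_def)
  then have "\<psi> \<in> characters G" by (simp add: characters_def \<psi>_def)
  moreover have "\<psi> x = cis (2 * pi / real p)"
    using chi[OF subgroup.one_closed[OF H], of 1] x by simp
  moreover have "p * card {g \<in> carrier G. \<psi> g = 1} = order G"
  proof -
    have ker: "{g \<in> carrier G. \<psi> g = 1} = H"
    proof safe
      fix g assume g: "g \<in> carrier G" "\<psi> g = 1"
      obtain h i where d: "h \<in> H" "g = h \<otimes> x [^] (i::int)" using dec g by meson
      then have "int p dvd i" using g(2) chi cis_2pi_of_int_div_eq_1_iff[OF p0] by simp
      then show "g \<in> H" using d mem H by (simp add: subgroup.m_closed)
    next
      fix h assume h: "h \<in> H"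
      show "h \<in> carrier G" using Hc h .
      show "\<psi> h = 1" using chi[OF h, of 0] Hc[OF h] by simp
    qed
    \<comment> \<open>The powers of \<open>x\<close> with exponents from 0 to \<open>p - 1\<close>
      represent the cosets of \<open>H\<close>, so \<open>H\<close> has index
      \<open>p\<close>.\<close>
    have "bij_betw (\<lambda>(h, i::int). h \<otimes> x [^] i) (H \<times> {0..<int p}) (carrier G)"
      unfolding bij_betw_def
    proof
      show "inj_on (\<lambda>(h, i::int). h \<otimes> x [^] i) (H \<times> {0..<int p})"
      proof (rule inj_onI, clarify)
        fix h h' and i j :: int
        assume *: "h \<in> H" "h' \<in> H" "i \<in> {0..<int p}" "j \<in> {0..<int p}" "h \<otimes> x [^] i = h' \<otimes> x [^] j"
        then have "i mod int p = j mod int p" using uniq by (simp only: mod_eq_dvd_iff)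
        then have "i = j" using * by simp
        with * show "h = h' \<and> i = j" using Hc x by simp
      qed
      show "(\<lambda>(h, i::int). h \<otimes> x [^] i) ` (H \<times> {0..<int p}) = carrier G"
      proof
        show "carrier G \<subseteq> (\<lambda>(h, i::int). h \<otimes> x [^] i) ` (H \<times> {0..<int p})"
        proof
          fix g assume g: "g \<in> carrier G"
          obtain h i where d: "h \<in> H" "g = h \<otimes> x [^] (i::int)" using dec g by meson
          have "x [^] (i - i mod int p) \<in> H" using mem by simp
          then have hH: "h \<otimes> x [^] (i - i mod int p) \<in> H" using d H by (simp add: subgroup.m_closed)
          have "h \<otimes> x [^] (i - i mod int p) \<otimes> x [^] (i mod int p) = g"
            using d Hc x by (simp add: m_assoc int_pow_mult[symmetric])
          then show "g \<in> (\<lambda>(h, i::int). h \<otimes> x [^] i) ` (H \<times> {0..<int p})"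
            using hH p0 by (intro image_eqI[of _ _ "(h \<otimes> x [^] (i - i mod int p), i mod int p)"]) auto
        qed
      qed (use Hc x in auto)
    qed
    then have "card (H \<times> {0..<int p}) = card (carrier G)" by (rule bij_betw_same_card)
    then show ?thesis unfolding ker by (simp add: order_def card_cartesian_product mult.commute)
  qed
  ultimately show thesis using x(1) that by blast
qed

section \<open>Cayley subsets and their complements\<close>

locale odd_abelian_group = comm_group G for G :: "('a, 'b) monoid_scheme" (structure) +
  assumes finite_carrier: "finite (carrier G)" and odd_order: "odd (order G)"
begin

text \<open>The property shared by a Cayley subset and its complement; whether the identity belongs
  to the set is stated separately, since exactly one of the two contains it.\<close>

definition symmetric_subset :: "'a set \<Rightarrow> bool" where
  "symmetric_subset T \<longleftrightarrow> T \<subseteq> carrier G \<and> (\<forall>x\<in>T. inv x \<in> T)"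

lemma finite_symmetric_subset: "symmetric_subset T \<Longrightarrow> finite T"
  using finite_carrier finite_subset by (auto simp: symmetric_subset_def)

section \<open>Inverse pairs and the sizes of symmetric subsets\<close>

lemma inv_neq_self:
  assumes "x \<in> carrier G" "x \<noteq> \<one>"
  shows "inv x \<noteq> x"
proof
  assume "inv x = x"
  then have "x [^] (2::nat) = \<one>"
    using assms r_inv[of x] by (simp add: numeral_2_eq_2)
  then have "ord x dvd 2" using assms by (simp add: pow_eq_id)
  moreover have "odd (ord x)"
    using ord_dvd_group_order[OF assms(1)] odd_order dvd_trans by blast
  ultimately have "ord x = 1"
    by (metis prime_nat_iff two_is_prime_nat)
  then show False using assms ord_eq_1 by blast
qed

text \<open>In odd order \<open>X\<close> splits into pairs of distinct mutual inverses, and one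
  pair is added at a time. The slack \<open>+ 1\<close> in the bound does no harm, as
  \<open>2 * k < card X + 1\<close> already leaves an element to add; it lets the parity of
  \<open>card X\<close> be derived by contradiction in
  \<open>even_card_symmetric_subset\<close>.\<close>

lemma symmetric_subset_even_part:
  assumes X: "symmetric_subset X" "\<one> \<notin> X" and k: "2 * k \<le> card X + 1"
  shows "\<exists>U\<subseteq>X. symmetric_subset U \<and> card U = 2 * k"
  using k
proof (induction k)
  case 0
  show ?case by (intro exI[of _ "{}"]) (simp add: symmetric_subset_def)
next
  case (Suc k)
  then obtain U where U: "U \<subseteq> X" "symmetric_subset U" "card U = 2 * k" by auto
  have fX: "finite X" using X finite_symmetric_subset by blast
  have "U \<noteq> X" using U Suc.prems by auto
  then obtain x where x: "x \<in> X" "x \<notin> U" using U by blast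
  have xc: "x \<in> carrier G" "inv x \<in> X" using x X by (auto simp: symmetric_subset_def)
  have "inv x \<notin> U" using U x xc by (metis inv_inv symmetric_subset_def)
  moreover have "inv x \<noteq> x" using inv_neq_self x xc X by metis
  ultimately have "card (insert x (insert (inv x) U)) = 2 * Suc k"
    using U x fX finite_subset[OF U(1)] by simp
  moreover have "symmetric_subset (insert x (insert (inv x) U))"
    using U xc by (auto simp: symmetric_subset_def)
  ultimately show ?case using U x xc by (intro exI[of _ "insert x (insert (inv x) U)"]) auto
qed

lemma even_card_symmetric_subset:
  assumes "symmetric_subset X" "\<one> \<notin> X"
  shows "even (card X)"
proof (rule ccontr)
  assume "odd (card X)"
  then have eq: "2 * ((card X + 1) div 2) = card X + 1" by simp
  obtain U where "U \<subseteq> X" "card U = card X + 1"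
    using symmetric_subset_even_part[OF assms, of "(card X + 1) div 2"] eq by auto
  then show False
    using card_mono[OF finite_symmetric_subset[OF assms(1)], of U] by simp
qed

text \<open>The identity together with inverse pairs realises every odd size. It is applied to
  character kernels, to make character sums large, and to the whole group, to realise
  covalencies.\<close>

lemma subgroup_odd_symmetric_subset:
  assumes K: "subgroup K G" and l: "odd l" "l \<le> card K"
  obtains T where "T \<subseteq> K" "symmetric_subset T" "\<one> \<in> T" "card T = l"
proof -
  have Kc: "K \<subseteq> carrier G" using subgroup.subset[OF K] .
  have "symmetric_subset (K - {\<one>})"
    using Kc K by (auto simp: symmetric_subset_def subgroup.m_inv_closed)
  moreover have "2 * (l div 2) \<le> card (K - {\<one>}) + 1"
    using subgroup.one_closed[OF K] l by simp
  ultimately obtain U where U: "U \<subseteq> K - {\<one>}" "symmetric_subset U" "card U = 2 * (l div 2)"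
    using symmetric_subset_even_part[of "K - {\<one>}" "l div 2"] by blast
  have "\<one> \<notin> U" using U(1) by blast
  then have "card (insert \<one> U) = l"
    using U(3) l finite_symmetric_subset[OF U(2)] by simp
  then show thesis
    using U subgroup.one_closed[OF K] by (intro that[of "insert \<one> U"]) (auto simp: symmetric_subset_def)
qed

section \<open>Cayley subsets as complements of symmetric sets\<close>

lemma cayley_subset_iff:
  "cayley_subset G S \<longleftrightarrow> symmetric_subset S \<and> \<one> \<notin> S \<and> generate G S = carrier G"
proof -
  have "S = (\<lambda>x. inv x) ` S \<longleftrightarrow> (\<forall>x\<in>S. inv x \<in> S)" if "S \<subseteq> carrier G"
  proof
    assume *: "\<forall>x\<in>S. inv x \<in> S"
    show "S = (\<lambda>x. inv x) ` S"
    proof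
      show "S \<subseteq> (\<lambda>x. inv x) ` S"
      proof
        fix x assume "x \<in> S"
        then show "x \<in> (\<lambda>x. inv x) ` S" using * that by (intro image_eqI[of _ _ "inv x"]) auto
      qed
    qed (use * in auto)
  qed blast
  then show ?thesis unfolding cayley_subset_def symmetric_subset_def by blast
qed

text \<open>The generated subgroup has index below 3, and the index is odd because it divides the
  odd order; so it is 1.\<close>

lemma generate_eq_carrier_if_large:
  assumes "S \<subseteq> carrier G" "order G < 3 * card S"
  shows "generate G S = carrier G"
proof -
  let ?H = "generate G S"
  have H: "subgroup ?H G" using assms(1) by (rule generate_is_subgroup)
  have fH: "finite ?H" using subgroup.subset[OF H] finite_carrier finite_subset by blast
  have "card S \<le> card ?H" using fH by (intro card_mono) (auto intro: generate.incl)
  moreover have lag: "card (rcosets ?H) * card ?H = order G" by (rule lagrange[OF H])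
  ultimately have "card (rcosets ?H) * card ?H < 3 * card ?H" using assms by linarith
  then have "card (rcosets ?H) < 3" by simp
  moreover have "odd (card (rcosets ?H))" using lag odd_order by (metis even_mult_iff)
  ultimately have "card (rcosets ?H) = 1" by presburger
  then have "card ?H = card (carrier G)" using lag by (simp add: order_def)
  then show ?thesis
    using subgroup.subset[OF H] finite_carrier by (intro card_subset_eq)
qed

text \<open>The size condition says that more than a third of the group remains outside
  \<open>T\<close>, which is enough for generation.\<close>

lemma cayley_subset_complement:
  assumes T: "symmetric_subset T" "\<one> \<in> T" and c: "3 * card T < 2 * order G"
  shows "cayley_subset G (carrier G - T)" "covalency G (carrier G - T) = int (card T)"
proof -
  have Tc: "T \<subseteq> carrier G" using T by (auto simp: symmetric_subset_def)
  have cT: "card T \<le> order G" unfolding order_def using Tc finite_carrier by (rule card_mono[rotated])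
  have card: "card (carrier G - T) = order G - card T"
    using Tc finite_symmetric_subset[OF T(1)] by (simp add: card_Diff_subset order_def)
  have "symmetric_subset (carrier G - T)"
    using T inv_inv by (auto simp: symmetric_subset_def)
  moreover have "generate G (carrier G - T) = carrier G"
    using c card cT by (intro generate_eq_carrier_if_large) auto
  ultimately show "cayley_subset G (carrier G - T)"
    using T by (simp add: cayley_subset_iff)
  show "covalency G (carrier G - T) = int (card T)"
    using card cT by (simp add: covalency_def)
qed

lemma cayley_subset_complementE:
  assumes "cayley_subset G S"
  obtains T where "symmetric_subset T" "\<one> \<in> T" "S = carrier G - T" "covalency G S = int (card T)"
    "card S = order G - card T" "card T \<le> order G"
proof -
  have S: "symmetric_subset S" "\<one> \<notin> S" using assms cayley_subset_iff by auto
  have Sc: "S \<subseteq> carrier G" using S by (auto simp: symmetric_subset_def)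
  have cS: "card S \<le> order G" unfolding order_def using Sc finite_carrier by (rule card_mono[rotated])
  have "card (carrier G - S) = order G - card S"
    using Sc finite_symmetric_subset[OF S(1)] by (simp add: card_Diff_subset order_def)
  moreover have "symmetric_subset (carrier G - S)"
    using S inv_inv by (auto simp: symmetric_subset_def)
  ultimately show thesis
    using S Sc cS by (intro that[of "carrier G - S"]) (auto simp: covalency_def)
qed

lemma odd_covalency:
  assumes "cayley_subset G S"
  shows "odd (covalency G S)"
  using even_card_symmetric_subset[of S] assms odd_order by (simp add: cayley_subset_iff covalency_def)

section \<open>The Ramanujan condition in terms of the complement\<close>

lemma cayley_eigenvalue_complement:
  assumes "\<psi> \<in> characters G" "\<psi> \<noteq> trivial_character G" "T \<subseteq> carrier G"
  shows "cayley_eigenvalue (carrier G - T) \<psi> = - (\<Sum>x\<in>T. \<psi> x)"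
  using sum_diff[OF finite_carrier assms(3), of \<psi>] sum_character_eq_0[OF finite_carrier assms(1,2)]
  by (simp add: cayley_eigenvalue_def)

text \<open>The \<open>Max\<close> in \<open>cayley_mu\<close> unfolds only over a finite nonempty
  set; nonemptiness comes from a character of prime order.\<close>

lemma ramanujan_iff:
  assumes "order G > 1"
  shows "ramanujan G S \<longleftrightarrow> (\<forall>\<psi>\<in>characters G. \<psi> \<noteq> trivial_character G \<longrightarrow>
           cmod (cayley_eigenvalue S \<psi>) \<le> 2 * sqrt (real (card S) - 1))"
proof -
  let ?E = "{cmod (cayley_eigenvalue S \<psi>) |\<psi>. \<psi> \<in> characters G \<and> \<psi> \<noteq> trivial_character G}"
  obtain p where p: "prime p" "p dvd order G" using assms prime_factor_nat[of "order G"] by auto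
  obtain \<psi> a where psi: "\<psi> \<in> characters G" "a \<in> carrier G" "\<psi> a = cis (2 * pi / real p)"
    using exists_character_prime_order[OF finite_carrier p] by blast
  have "\<psi> a \<noteq> 1"
    using cis_2pi_of_int_div_eq_1_iff[of p 1] p psi prime_gt_1_nat[OF p(1)] by simp
  then have "\<psi> \<noteq> trivial_character G" using psi(2) by (auto simp: trivial_character_def)
  then have "?E \<noteq> {}" using psi by blast
  moreover have "finite ?E"
    using finite_characters[OF finite_carrier] by simp
  ultimately show ?thesis
    unfolding ramanujan_def cayley_mu_def by (subst Max_le_iff) auto
qed

lemma ramanujan_complement_iff:
  assumes "order G > 1" "symmetric_subset T"
  shows "ramanujan G (carrier G - T) \<longleftrightarrow> (\<forall>\<psi>\<in>characters G. \<psi> \<noteq> trivial_character G \<longrightarrow>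
           cmod (\<Sum>x\<in>T. \<psi> x) \<le> 2 * sqrt (real (order G) - real (card T) - 1))"
proof -
  have Tc: "T \<subseteq> carrier G" using assms by (auto simp: symmetric_subset_def)
  have "card T \<le> order G" unfolding order_def using Tc finite_carrier by (rule card_mono[rotated])
  then have "real (card (carrier G - T)) = real (order G) - real (card T)"
    using Tc finite_symmetric_subset[OF assms(2)] by (simp add: card_Diff_subset order_def)
  then show ?thesis
    unfolding ramanujan_iff[OF assms(1)] using cayley_eigenvalue_complement[OF _ _ Tc] by simp
qed

text \<open>The trivial bound \<open>card T\<close> for the character sum is enough: the hypothesis
  is its comparison with \<open>2 * sqrt (order G - card T - 1)\<close>, squared and with the square
  completed.\<close>

lemma ramanujan_if_covalency_small:
  assumes "order G > 1" "cayley_subset G S" "(covalency G S + 2)\<^sup>2 \<le> 4 * int (order G)"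
  shows "ramanujan G S"
proof -
  obtain T where T: "symmetric_subset T" "S = carrier G - T" "covalency G S = int (card T)"
    by (rule cayley_subset_complementE[OF assms(2)])
  have "real_of_int ((int (card T) + 2)\<^sup>2) \<le> real_of_int (4 * int (order G))"
    using assms(3) T(3) by (simp only: of_int_le_iff)
  then have "(real (card T))\<^sup>2 \<le> 4 * (real (order G) - real (card T) - 1)"
    by (simp add: power2_sum)
  then have "real (card T) \<le> sqrt (4 * (real (order G) - real (card T) - 1))"
    by (rule real_le_rsqrt)
  then have le: "real (card T) \<le> 2 * sqrt (real (order G) - real (card T) - 1)"
    by (subst (asm) real_sqrt_mult) simp
  have "cmod (\<Sum>x\<in>T. \<psi> x) \<le> real (card T)" if "\<psi> \<in> characters G" for \<psi>
  proof -
    have "cmod (\<psi> x) \<le> 1" if "x \<in> T" for x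
      using norm_character[OF finite_carrier \<open>\<psi> \<in> characters G\<close>] T(1) that
      by (auto simp: symmetric_subset_def)
    then show ?thesis using sum_norm_le[of T \<psi> "\<lambda>_. 1"] by simp
  qed
  with le show ?thesis
    unfolding T(2) ramanujan_complement_iff[OF assms(1) T(1)] by fastforce
qed

lemma exists_cayley_subset_covalency:
  assumes "odd l" "3 * l < 2 * order G"
  obtains S where "cayley_subset G S" "covalency G S = int l"
proof -
  have "l \<le> card (carrier G)" using assms(2) by (simp add: order_def)
  then obtain T where "T \<subseteq> carrier G" "symmetric_subset T" "\<one> \<in> T" "card T = l"
    by (rule subgroup_odd_symmetric_subset[OF subgroup_self assms(1)])
  then show thesis using cayley_subset_complement[of T] assms(2) by (intro that[of "carrier G - T"]) simp_all
qed

section \<open>Evaluating \<open>l_hat\<close>\<close>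

lemma l_hat_set_finite:
  "finite {l. (\<exists>S. cayley_subset G S \<and> covalency G S = l) \<and> P l}"
proof (rule finite_subset)
  show "{l. (\<exists>S. cayley_subset G S \<and> covalency G S = l) \<and> P l} \<subseteq> {0..int (order G)}"
  proof clarify
    fix S assume "cayley_subset G S"
    then obtain T :: "'a set" where "covalency G S = int (card T)" "card T \<le> order G"
      by (rule cayley_subset_complementE)
    then show "covalency G S \<in> {0..int (order G)}" by simp
  qed
qed simp

text \<open>The first two assumptions guarantee that \<open>l\<close> is attained as a covalency, as
  the maximum defining \<open>l_hat\<close> demands.\<close>

lemma l_hat_ge:
  assumes "odd l" "3 * l < 2 * order G"
    and ram: "\<And>S. cayley_subset G S \<Longrightarrow> covalency G S \<le> int l \<Longrightarrow> ramanujan G S"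
  shows "int l \<le> l_hat G"
proof -
  obtain S where "cayley_subset G S" "covalency G S = int l"
    using exists_cayley_subset_covalency[OF assms(1,2)] .
  then show ?thesis
    unfolding l_hat_def using ram by (intro Max_ge[OF l_hat_set_finite]) blast
qed

text \<open>The complement of \<open>T\<close> excludes every candidate from \<open>l + 2\<close>
  on, and since covalencies are odd none lies strictly between \<open>l\<close> and
  \<open>l + 2\<close>.\<close>

lemma l_hat_eq:
  assumes "odd l" "3 * l < 2 * order G"
    and ram: "\<And>S. cayley_subset G S \<Longrightarrow> covalency G S \<le> int l \<Longrightarrow> ramanujan G S"
    and T: "symmetric_subset T" "\<one> \<in> T" "card T = l + 2" "3 * (l + 2) < 2 * order G"
    and nram: "\<not> ramanujan G (carrier G - T)"
  shows "l_hat G = int l"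
proof -
  obtain S where S: "cayley_subset G S" "covalency G S = int l"
    using exists_cayley_subset_covalency[OF assms(1,2)] .
  show ?thesis
    unfolding l_hat_def
  proof (rule Max_eqI)
    fix k assume k: "k \<in> {k. (\<exists>S. cayley_subset G S \<and> covalency G S = k) \<and>
                       (\<forall>S. cayley_subset G S \<and> covalency G S \<le> k \<longrightarrow> ramanujan G S)}"
    then have "odd k" using odd_covalency by blast
    have "\<not> int (l + 2) \<le> k"
    proof
      assume "int (l + 2) \<le> k"
      then have "ramanujan G (carrier G - T)"
        using k cayley_subset_complement[OF T(1,2)] T(3,4) by simp
      with nram show False by simp
    qed
    with \<open>odd k\<close> assms(1) show "k \<le> int l" by presburger
  next
    show "finite {k. (\<exists>S. cayley_subset G S \<and> covalency G S = k) \<and>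
            (\<forall>S. cayley_subset G S \<and> covalency G S \<le> k \<longrightarrow> ramanujan G S)}"
      by (rule l_hat_set_finite)
    show "int l \<in> {k. (\<exists>S. cayley_subset G S \<and> covalency G S = k) \<and>
            (\<forall>S. cayley_subset G S \<and> covalency G S \<le> k \<longrightarrow> ramanujan G S)}"
      using S ram by blast
  qed
qed

end

section \<open>Cosines and roots of unity\<close>

lemma cos_ge_quadratic: "1 - x\<^sup>2 / 2 \<le> cos (x::real)"
proof -
  obtain t where "cos x = (\<Sum>m<2. cos_coeff m * x ^ m) + cos (t + 1/2 * real 2 * pi) / fact 2 * x ^ 2"
    using Maclaurin_cos_expansion[of x 2] by blast
  then have "cos x = 1 - cos t * x\<^sup>2 / 2"
    by (simp add: cos_coeff_def numeral_2_eq_2)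
  moreover have "cos t * x\<^sup>2 \<le> 1 * x\<^sup>2" by (intro mult_right_mono) auto
  ultimately show ?thesis by simp
qed

lemma cos_le_quartic: "cos (x::real) \<le> 1 - x\<^sup>2 / 2 + x ^ 4 / 24"
proof -
  obtain t where "cos x = (\<Sum>m<4. cos_coeff m * x ^ m) + cos (t + 1/2 * real 4 * pi) / fact 4 * x ^ 4"
    using Maclaurin_cos_expansion[of x 4] by blast
  moreover have "cos (t + 1/2 * real 4 * pi) = cos t" using cos_periodic[of t] by simp
  ultimately have "cos x = 1 - x\<^sup>2 / 2 + cos t * x ^ 4 / 24"
    by (simp add: cos_coeff_def lessThan_nat_numeral lessThan_Suc fact_numeral)
  moreover have "cos t * x ^ 4 \<le> 1 * x ^ 4" by (intro mult_right_mono) auto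
  ultimately show ?thesis by simp
qed

text \<open>The quartic bound decreases while the square of its argument is at most 6, so a smaller
  rational argument may replace \<open>x\<close>. The product in the proof is 24 times the
  difference of the quartic at \<open>a\<close> and at \<open>x\<close>.\<close>

lemma cos_le_quartic_mono:
  fixes a x :: real
  assumes "0 \<le> a" "a \<le> x" "x\<^sup>2 \<le> 6"
  shows "cos x \<le> 1 - a\<^sup>2 / 2 + a ^ 4 / 24"
proof -
  have le: "a\<^sup>2 \<le> x\<^sup>2" using assms by (simp add: power_mono)
  have "0 \<le> (x\<^sup>2 - a\<^sup>2) * (12 - x\<^sup>2 - a\<^sup>2)" using le assms(3) by (intro mult_nonneg_nonneg) linarith+
  also have "\<dots> = 12 * x\<^sup>2 - 12 * a\<^sup>2 - x ^ 4 + a ^ 4" by (simp add: algebra_simps power2_eq_square eval_nat_numeral)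
  finally show ?thesis using cos_le_quartic[of x] by simp
qed

text \<open>The constant 63/10 is a rational upper bound for \<open>2 * pi\<close>.\<close>

lemma cos_2pi_div_ge: "1 - (63 / 10 / real p)\<^sup>2 / 2 \<le> cos (2 * pi / real p)"
proof -
  have "(2 * pi / real p)\<^sup>2 \<le> (63 / 10 / real p)\<^sup>2"
    using pi_approx(2) by (intro power_mono divide_right_mono) auto
  then show ?thesis using cos_ge_quadratic[of "2 * pi / real p"] by linarith
qed

text \<open>The constant 157/25 is a rational lower bound for \<open>2 * pi\<close>;
  \<open>p \<ge> 3\<close> keeps the angle in the range where the quartic decreases.\<close>

lemma cos_2pi_div_le:
  assumes "p \<ge> 3"
  shows "cos (2 * pi / real p) \<le> 1 - (157 / 25 / real p)\<^sup>2 / 2 + (157 / 25 / real p) ^ 4 / 24"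
proof (rule cos_le_quartic_mono)
  show "157 / 25 / real p \<le> 2 * pi / real p"
    using pi_approx(1) by (intro divide_right_mono) auto
  have "2 * pi / real p \<le> 63 / 10 / 3"
    using pi_approx(2) assms by (intro frac_le) auto
  then have "(2 * pi / real p)\<^sup>2 \<le> (63 / 10 / 3)\<^sup>2" by (intro power_mono) auto
  then show "(2 * pi / real p)\<^sup>2 \<le> 6" by (simp add: power2_eq_square)
qed auto

section \<open>Real parts of roots of unity\<close>

lemma root_of_unity_cisE:
  assumes "p > 0" "z ^ p = 1"
  obtains k where "k < p" "z = cis (2 * pi * real k / real p)"
proof -
  have "z \<in> (\<lambda>k. cis (2 * pi * real k / real p)) ` {..<p}"
    using Complex.bij_betw_roots_unity[OF assms(1)] assms(2) by (simp add: bij_betw_def)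
  then show thesis using that by blast
qed

lemma Re_root_of_unity_le:
  assumes p: "p > 1" and z: "z ^ p = 1" "z \<noteq> 1"
  shows "Re z \<le> cos (2 * pi / real p)"
proof -
  obtain k where k: "k < p" "z = cis (2 * pi * real k / real p)"
    using root_of_unity_cisE[OF _ z(1)] p by auto
  have "k \<noteq> 0" using z(2) by (intro notI) (simp add: k(2))
  \<comment> \<open>Conjugation moves the angle into the interval from \<open>2 * pi / p\<close> to
    \<open>pi\<close>, where the cosine decreases.\<close>
  define j where "j = (if 2 * k \<le> p then k else p - k)"
  have j: "1 \<le> j" "2 * j \<le> p" using k(1) \<open>k \<noteq> 0\<close> by (auto simp: j_def)
  have "Re z = cos (2 * pi * real j / real p)"
  proof (cases "2 * k \<le> p")
    case False
    have "2 * pi * real j / real p = 2 * pi - 2 * pi * real k / real p"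
      using False k(1) p by (simp add: j_def field_simps)
    then show ?thesis using k(2) by (simp add: cos_diff)
  qed (simp add: j_def k(2))
  also have "\<dots> \<le> cos (2 * pi / real p)"
  proof (rule cos_monotone_0_pi_le)
    show "2 * pi / real p \<le> 2 * pi * real j / real p"
      using j(1) by (intro divide_right_mono) auto
    have "real (2 * j) \<le> real p" using j(2) by (simp only: of_nat_le_iff)
    then show "2 * pi * real j / real p \<le> pi" using p by (simp add: field_simps)
  qed simp
  finally show ?thesis .
qed

text \<open>Measured from -1, the angle of \<open>z\<close> is \<open>pi * j / p\<close> with
  \<open>j = \<bar>p - 2 * k\<bar>\<close>, and \<open>j \<ge> 1\<close> because \<open>p\<close> is
  odd.\<close>

lemma Re_root_of_unity_ge:
  assumes p: "odd p" and z: "z ^ p = 1"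
  shows "- cos (pi / real p) \<le> Re z"
proof -
  have p0: "p > 0" using p by (cases p) auto
  obtain k where k: "k < p" "z = cis (2 * pi * real k / real p)"
    using root_of_unity_cisE[OF p0 z] by blast
  define j where "j = nat \<bar>int p - 2 * int k\<bar>"
  have "2 * k \<noteq> p" using p by auto
  then have j: "1 \<le> j" "j \<le> p" using k(1) by (auto simp: j_def)
  have rj: "real j = \<bar>real p - 2 * real k\<bar>" by (simp add: j_def)
  have "\<bar>pi - 2 * pi * real k / real p\<bar> = \<bar>pi * (real p - 2 * real k) / real p\<bar>"
    using p0 by (simp add: field_simps)
  also have "\<dots> = pi * real j / real p" by (simp add: rj abs_mult)
  finally have "cos (pi * real j / real p) = cos (pi - 2 * pi * real k / real p)"
    by (metis cos_abs_real)
  then have "Re z = - cos (pi * real j / real p)" using k(2) by (simp add: cos_diff)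
  moreover have "cos (pi * real j / real p) \<le> cos (pi / real p)"
  proof (rule cos_monotone_0_pi_le)
    show "pi / real p \<le> pi * real j / real p"
      using j(1) by (intro divide_right_mono) auto
    show "pi * real j / real p \<le> pi" using p0 j(2) by (simp add: field_simps)
  qed simp
  ultimately show ?thesis by simp
qed

section \<open>The covalency bounds\<close>

context odd_abelian_group
begin

text \<open>Floor and square root are traded for integer inequalities: \<open>l_zero G\<close> is
  the largest odd \<open>l\<close> with \<open>(l + 2)\<^sup>2 \<le> 4 * order G\<close>.\<close>

lemma l_zero_bounds:
  assumes "order G \<ge> 9"
  shows "odd (l_zero G)" "l_zero G \<ge> 3" "(l_zero G + 2)\<^sup>2 \<le> 4 * int (order G)"
    "4 * int (order G) < (l_zero G + 4)\<^sup>2"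
proof -
  define f where "f = \<lfloor>sqrt (real (order G)) - 3 / 2\<rfloor>"
  have l: "l_zero G = 2 * f + 1" by (simp add: l_zero_def f_def)
  have f: "real_of_int f \<le> sqrt (real (order G)) - 3 / 2" "sqrt (real (order G)) - 3 / 2 < real_of_int f + 1"
    unfolding f_def by linarith+
  have "sqrt 9 \<le> sqrt (real (order G))" using assms by (intro real_sqrt_le_mono) simp
  then have s: "3 \<le> sqrt (real (order G))" by simp
  then have "real_of_int f > 0" using f by linarith
  then have f1: "f \<ge> 1" by simp
  show "odd (l_zero G)" "l_zero G \<ge> 3" using l f1 by auto
  have "(real_of_int (l_zero G + 2))\<^sup>2 \<le> (2 * sqrt (real (order G)))\<^sup>2"
    using f f1 l by (intro power_mono) auto
  then have "real_of_int ((l_zero G + 2)\<^sup>2) \<le> real_of_int (4 * int (order G))"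
    by (simp add: power_mult_distrib)
  then show "(l_zero G + 2)\<^sup>2 \<le> 4 * int (order G)" by (simp only: of_int_le_iff)
  have "(2 * sqrt (real (order G)))\<^sup>2 < (real_of_int (l_zero G + 4))\<^sup>2"
    using f s l by (intro power_strict_mono) auto
  then have "real_of_int (4 * int (order G)) < real_of_int ((l_zero G + 4)\<^sup>2)"
    by (simp add: power_mult_distrib)
  then show "4 * int (order G) < (l_zero G + 4)\<^sup>2" by (simp only: of_int_less_iff)
qed

lemma l_zero_square:
  assumes "order G = p\<^sup>2"
  shows "l_zero G = 2 * int p - 3"
proof -
  have "\<lfloor>real p - 3 / 2\<rfloor> = int p - 2" by linarith
  then show ?thesis using assms by (simp add: l_zero_def)
qed

lemma ramanujan_up_to_l_zero:
  assumes "order G \<ge> 9" "cayley_subset G S" "covalency G S \<le> l_zero G"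
  shows "ramanujan G S"
proof (rule ramanujan_if_covalency_small)
  obtain T :: "'a set" where "covalency G S = int (card T)"
    using assms(2) by (rule cayley_subset_complementE)
  then have "(covalency G S + 2)\<^sup>2 \<le> (l_zero G + 2)\<^sup>2"
    using assms(3) by (intro power_mono) auto
  then show "(covalency G S + 2)\<^sup>2 \<le> 4 * int (order G)"
    using l_zero_bounds(3)[OF assms(1)] by linarith
qed (use assms in auto)

text \<open>Reduces a claim about all covalencies up to \<open>l\<close> to the few odd sizes above
  \<open>l_zero G\<close>, phrased for complements.\<close>

lemma ramanujan_up_to:
  assumes ord: "order G \<ge> 9"
    and *: "\<And>T. symmetric_subset T \<Longrightarrow> \<one> \<in> T \<Longrightarrow> int (card T) > l_zero G \<Longrightarrow> odd (card T) \<Longrightarrow> card T \<le> l \<Longrightarrow>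
      ramanujan G (carrier G - T)"
    and S: "cayley_subset G S" "covalency G S \<le> int l"
  shows "ramanujan G S"
proof (cases "covalency G S \<le> l_zero G")
  case True
  then show ?thesis using ramanujan_up_to_l_zero[OF ord S(1)] by blast
next
  case False
  obtain T where T: "symmetric_subset T" "\<one> \<in> T" "S = carrier G - T" "covalency G S = int (card T)"
    using S(1) by (rule cayley_subset_complementE)
  have "odd (card T)" using odd_covalency[OF S(1)] T(4) by simp
  then show ?thesis using T False S(2) * by auto
qed

lemma nontrivial_if_value_neq_1:
  assumes "a \<in> carrier G" "\<psi> a \<noteq> 1"
  shows "\<psi> \<noteq> trivial_character G"
  using assms by (auto simp: trivial_character_def)

text \<open>Inside a kernel the trivial bound \<open>card T\<close> is attained, so a symmetric
  \<open>T\<close> with \<open>l_zero G + 2\<close> elements there violates the Ramanujan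
  bound.\<close>

lemma ordinary_if_large_kernel:
  assumes ord: "order G > 9" and q: "prime q" "q dvd order G"
    and le: "(l_zero G + 2) * int q \<le> int (order G)"
  shows "ordinary G"
proof -
  define l where "l = nat (l_zero G)"
  note b = l_zero_bounds[OF less_imp_le[OF ord]]
  have l: "int l = l_zero G" using b(2) by (simp add: l_def)
  have oddl: "odd l" using b(1) by (simp flip: l)
  obtain \<psi> a where psi: "\<psi> \<in> characters G" "a \<in> carrier G" "\<psi> a = cis (2 * pi / real q)"
    and card: "q * card {x \<in> carrier G. \<psi> x = 1} = order G"
    using exists_character_prime_order[OF finite_carrier q] by blast
  have q1: "q > 1" using q(1) prime_gt_1_nat by blast
  have "\<psi> a \<noteq> 1" using cis_2pi_of_int_div_eq_1_iff[of q 1] q1 psi by simp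
  then have nt: "\<psi> \<noteq> trivial_character G" using psi(2) nontrivial_if_value_neq_1 by blast
  have "int (q * (l + 2)) \<le> int (order G)"
    using le by (simp add: l algebra_simps)
  then have "q * (l + 2) \<le> q * card {x \<in> carrier G. \<psi> x = 1}"
    unfolding card by (simp only: of_nat_le_iff)
  then have lK: "l + 2 \<le> card {x \<in> carrier G. \<psi> x = 1}" using q1 by (simp only: mult_le_cancel1)
  obtain T where T: "T \<subseteq> {x \<in> carrier G. \<psi> x = 1}" "symmetric_subset T" "\<one> \<in> T" "card T = l + 2"
    using subgroup_odd_symmetric_subset[OF subgroup_character_kernel[OF finite_carrier psi(1)] _ lK] oddl
    by auto
  have "(\<Sum>x\<in>T. \<psi> x) = (\<Sum>x\<in>T. 1)" using T(1) by (intro sum.cong) auto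
  also have "\<dots> = of_nat (l + 2)" unfolding T(4)[symmetric] by simp
  finally have norm: "cmod (\<Sum>x\<in>T. \<psi> x) = real (l + 2)" by (simp only: norm_of_nat)
  \<comment> \<open>Otherwise squaring and \<open>(l + 2)\<^sup>2 \<le> 4 * order G\<close> would
    give \<open>order G \<le> 9\<close>.\<close>
  have small: "3 * (l + 2) < 2 * order G"
  proof (rule ccontr)
    assume "\<not> 3 * (l + 2) < 2 * order G"
    then have "int (2 * order G) \<le> int (3 * (l + 2))" by (simp only: of_nat_le_iff not_less)
    then have "2 * int (order G) \<le> 3 * (l_zero G + 2)" using l by simp
    then have "(2 * int (order G))\<^sup>2 \<le> (3 * (l_zero G + 2))\<^sup>2" by (intro power_mono) auto
    also have "\<dots> \<le> 9 * (4 * int (order G))" unfolding power_mult_distrib using b(3) by simp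
    finally have "int (order G) * int (order G) \<le> 9 * int (order G)" by (simp add: power2_eq_square)
    then show False using ord by simp
  qed
  have "\<not> ramanujan G (carrier G - T)"
  proof
    assume "ramanujan G (carrier G - T)"
    then have "cmod (\<Sum>x\<in>T. \<psi> x) \<le> 2 * sqrt (real (order G) - real (card T) - 1)"
      using ramanujan_complement_iff[OF _ T(2)] ord psi(1) nt by simp
    then have "real (l + 2) \<le> 2 * sqrt (real (order G) - real (l + 2) - 1)"
      using norm T(4) by simp
    then have "(real (l + 2))\<^sup>2 \<le> (2 * sqrt (real (order G) - real (l + 2) - 1))\<^sup>2"
      by (intro power_mono) auto
    also have "\<dots> = 4 * (real (order G) - real (l + 2) - 1)"
      using small by (simp add: power_mult_distrib)
    finally have "(real l + 4)\<^sup>2 \<le> 4 * real (order G)"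
      by (simp add: power2_eq_square algebra_simps)
    then have "real_of_int ((int l + 4)\<^sup>2) \<le> real_of_int (4 * int (order G))" by simp
    then have "(int l + 4)\<^sup>2 \<le> 4 * int (order G)" by (simp only: of_int_le_iff)
    then show False using b(4) l by simp
  qed
  then have "l_hat G = int l"
    using small T(2,3,4) oddl ramanujan_up_to_l_zero[OF less_imp_le[OF ord]] l
    by (intro l_hat_eq[of l T]) auto
  then show ?thesis using l by (simp add: ordinary_def)
qed

section \<open>Noncyclic groups of order \<open>p\<^sup>2\<close>: extremal character sums\<close>

lemma norm_sum_character_le:
  assumes p: "prime p" "order G = p\<^sup>2" and nc: "\<not> cyclic_group G"
    and psi: "\<psi> \<in> characters G" "\<psi> \<noteq> trivial_character G"
    and T: "symmetric_subset T" "\<one> \<in> T"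
  shows "cmod (\<Sum>x\<in>T. \<psi> x) \<le> max (real p + (real (card T) - real p) * cos (2 * pi / real p))
           ((real (card T) - 1) * cos (pi / real p) - 1)"
proof -
  have p1: "p > 1" using p(1) prime_gt_1_nat by blast
  have oddp: "odd p" using p(2) odd_order by simp
  let ?c = "cos (2 * pi / real p)" and ?d = "cos (pi / real p)"
  have Tc: "T \<subseteq> carrier G" using T by (auto simp: symmetric_subset_def)
  have fT: "finite T" using T finite_symmetric_subset by blast
  define K where "K = {x \<in> carrier G. \<psi> x = 1}"
  have K: "subgroup K G" unfolding K_def by (rule subgroup_character_kernel[OF finite_carrier psi(1)])
  have fK: "finite K" using finite_carrier by (simp add: K_def)
  have "K \<noteq> carrier G" using character_nontrivial[OF psi] by (auto simp: K_def)
  then have "card K \<noteq> order G"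
    using card_subset_eq[OF finite_carrier, of K] by (auto simp: K_def order_def)
  moreover have "card K dvd p ^ 2" using lagrange[OF K] p(2) by (metis dvd_triv_right)
  then obtain i where i: "i \<le> 2" "card K = p ^ i" using divides_primepow_nat[OF p(1)] by blast
  ultimately have "i \<le> 1" using p(2) by (cases "i = 2") auto
  then have cK: "card K \<le> p" using i(2) p1 power_increasing[of i 1 p] by simp
  have root: "\<psi> x ^ p = 1" if "x \<in> carrier G" for x
    using pow_prime_eq_one_if_order_square[OF finite_carrier nc p that] character_pow[OF psi(1) that, of p]
      character_one[OF psi(1)] by simp
  \<comment> \<open>Symmetry of \<open>T\<close> makes the sum real, so two one-sided estimates of
    real parts suffice.\<close>
  have "cnj (\<Sum>x\<in>T. \<psi> x) = (\<Sum>x\<in>T. \<psi> (inv x))"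
    using character_inv[OF finite_carrier psi(1)] Tc by (simp add: subset_iff)
  also have "\<dots> = (\<Sum>x\<in>T. \<psi> x)"
    by (rule sum.reindex_bij_witness[of _ "\<lambda>x. inv x" "\<lambda>x. inv x"])
      (use T in \<open>auto simp: symmetric_subset_def\<close>)
  finally have "(\<Sum>x\<in>T. \<psi> x) \<in> \<real>" by (simp add: Reals_cnj_iff)
  then have norm: "cmod (\<Sum>x\<in>T. \<psi> x) = \<bar>Re (\<Sum>x\<in>T. \<psi> x)\<bar>"
    by (simp add: in_Reals_norm)
  \<comment> \<open>At most \<open>p\<close> elements lie in the kernel and contribute 1; every
    other one contributes at most \<open>cos (2 * pi / p)\<close>.\<close>
  have upper: "Re (\<Sum>x\<in>T. \<psi> x) \<le> real p + (real (card T) - real p) * ?c"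
  proof -
    have "Re (\<Sum>x\<in>T. \<psi> x) = (\<Sum>x\<in>T. Re (\<psi> x))" by simp
    also have "\<dots> \<le> (\<Sum>x\<in>T. ?c + (if x \<in> K then 1 - ?c else 0))"
    proof (rule sum_mono)
      fix x assume x: "x \<in> T"
      show "Re (\<psi> x) \<le> ?c + (if x \<in> K then 1 - ?c else 0)"
        using Re_root_of_unity_le[OF p1 root] x Tc by (auto simp: K_def)
    qed
    also have "\<dots> = real (card T) * ?c + real (card (T \<inter> K)) * (1 - ?c)"
      using fT by (simp add: sum.distrib sum.If_cases)
    also have "real (card (T \<inter> K)) * (1 - ?c) \<le> real p * (1 - ?c)"
      using card_mono[OF fK, of "T \<inter> K"] cK by (intro mult_right_mono) auto
    finally show ?thesis by (simp add: algebra_simps)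
  qed
  \<comment> \<open>The identity contributes 1, and every other element at least
    \<open>- cos (pi / p)\<close>.\<close>
  have lower: "Re (\<Sum>x\<in>T. \<psi> x) \<ge> 1 - (real (card T) - 1) * ?d"
  proof -
    have "(\<Sum>x\<in>T - {\<one>}. - ?d) \<le> (\<Sum>x\<in>T - {\<one>}. Re (\<psi> x))"
      using Re_root_of_unity_ge[OF oddp root] Tc by (intro sum_mono) auto
    moreover have "(\<Sum>x\<in>T. Re (\<psi> x)) = Re (\<psi> \<one>) + (\<Sum>x\<in>T - {\<one>}. Re (\<psi> x))"
      using fT T(2) by (rule sum.remove)
    moreover have "real (card (T - {\<one>})) = real (card T) - 1"
    proof -
      have "card T \<ge> 1" using T(2) fT by (metis One_nat_def Suc_leI card_gt_0_iff empty_iff)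
      then show ?thesis using T(2) by simp
    qed
    ultimately show ?thesis using character_one[OF psi(1)] by simp
  qed
  show ?thesis unfolding norm using upper lower by linarith
qed

text \<open>The upper estimate is attained: \<open>T\<close> consists of the kernel,
  \<open>k\<close> elements of the coset with value \<open>cis (2 * pi / p)\<close>, and their
  inverses, which take the conjugate value.\<close>

lemma exists_character_sum_eq:
  assumes p: "prime p" "order G = p\<^sup>2" and k: "k \<le> p"
  obtains \<psi> T where "\<psi> \<in> characters G" "\<psi> \<noteq> trivial_character G" "symmetric_subset T" "\<one> \<in> T"
    "card T = p + 2 * k" "(\<Sum>x\<in>T. \<psi> x) = of_real (real p + 2 * real k * cos (2 * pi / real p))"
proof -
  have p1: "p > 1" using p(1) prime_gt_1_nat by blast
  have "odd p" using p(2) odd_order by simp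
  then have p3: "p \<ge> 3" using p1 by presburger
  let ?w = "cis (2 * pi / real p)"
  obtain \<psi> a where psi: "\<psi> \<in> characters G" and a: "a \<in> carrier G" "\<psi> a = ?w"
    and card: "p * card {x \<in> carrier G. \<psi> x = 1} = order G"
    using exists_character_prime_order[OF finite_carrier p(1)] p(2) by auto
  \<comment> \<open>Since \<open>p \<ge> 3\<close>, the values 1, \<open>?w\<close> and
    \<open>cnj ?w\<close> are distinct, so the three pieces of \<open>T\<close> are
    disjoint.\<close>
  have "Im ?w > 0" using p3 by (auto intro!: sin_gt_zero simp: field_simps)
  then have w: "?w \<noteq> 1" "cnj ?w \<noteq> 1" "cnj ?w \<noteq> ?w" by (auto simp: complex_eq_iff)
  have nt: "\<psi> \<noteq> trivial_character G" using a w(1) nontrivial_if_value_neq_1 by metis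
  define K where "K = {x \<in> carrier G. \<psi> x = 1}"
  have K: "subgroup K G" unfolding K_def by (rule subgroup_character_kernel[OF finite_carrier psi])
  have fK: "finite K" using finite_carrier by (simp add: K_def)
  have cK: "card K = p" using card p(2) p1 by (simp add: K_def power2_eq_square)
  have Kc: "K \<subseteq> carrier G" by (auto simp: K_def)
  have "inj_on (\<lambda>x. a \<otimes> x) K" using inj_on_subset[OF inj_on_cmult[OF a(1)] Kc] .
  then have "card ((\<lambda>x. a \<otimes> x) ` K) = p" by (simp add: card_image cK)
  then obtain U where U: "U \<subseteq> (\<lambda>x. a \<otimes> x) ` K" "card U = k" "finite U"
    using obtain_subset_with_card_n k by metis
  have Uc: "x \<in> carrier G" "\<psi> x = ?w" if "x \<in> U" for x
    using that U(1) a character_mult[OF psi] by (auto simp: K_def)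
  define V where "V = (\<lambda>x. inv x) ` U"
  have "inj_on (\<lambda>x. inv x) U" using Uc(1) by (intro inj_on_subset[OF inv_inj]) auto
  then have cV: "card V = k" by (simp add: V_def card_image U(2))
  have Vc: "x \<in> carrier G" "\<psi> x = cnj ?w" if "x \<in> V" for x
    using that Uc character_inv[OF finite_carrier psi] by (auto simp: V_def)
  have fV: "finite V" using U by (simp add: V_def)
  have "\<psi> x = 1" if "x \<in> K" for x using that by (simp add: K_def)
  then have disj: "K \<inter> U = {}" "(K \<union> U) \<inter> V = {}"
    using Uc(2) Vc(2) w unfolding disjoint_iff by (metis, metis UnE)
  define T where "T = K \<union> U \<union> V"
  have "symmetric_subset T"
    unfolding symmetric_subset_def
  proof (intro conjI ballI)
    show "T \<subseteq> carrier G" using Kc Uc Vc by (auto simp: T_def)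
    fix x assume "x \<in> T"
    then consider "x \<in> K" | "x \<in> U" | "x \<in> V" by (auto simp: T_def)
    then show "inv x \<in> T"
    proof cases
      case 1
      then show ?thesis using subgroup.m_inv_closed[OF K] by (simp add: T_def)
    next
      case 2
      then show ?thesis by (simp add: T_def V_def)
    next
      case 3
      then obtain u where "u \<in> U" "x = inv u" by (auto simp: V_def)
      then show ?thesis using Uc by (simp add: T_def)
    qed
  qed
  moreover have "card T = p + 2 * k"
    using disj fK U(2,3) fV cK cV by (simp add: T_def card_Un_disjoint)
  moreover have "(\<Sum>x\<in>T. \<psi> x) = of_real (real p + 2 * real k * cos (2 * pi / real p))"
  proof -
    have "(\<Sum>x\<in>T. \<psi> x) = (\<Sum>x\<in>K. \<psi> x) + (\<Sum>x\<in>U. \<psi> x) + (\<Sum>x\<in>V. \<psi> x)"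
      using disj fK U(3) fV by (simp add: T_def sum.union_disjoint)
    also have "(\<Sum>x\<in>K. \<psi> x) = of_nat p" using cK by (simp add: K_def)
    also have "(\<Sum>x\<in>U. \<psi> x) = of_nat k * ?w" using Uc(2) U(2) by simp
    also have "(\<Sum>x\<in>V. \<psi> x) = of_nat k * cnj ?w" using Vc(2) cV by simp
    finally show ?thesis by (simp add: complex_eq_iff)
  qed
  moreover have "\<one> \<in> T" using subgroup.one_closed[OF K] by (simp add: T_def)
  ultimately show thesis using psi nt that by blast
qed

lemma not_ramanujan_prime_square:
  assumes p: "prime p" "order G = p\<^sup>2" and k: "k \<le> p"
    and gt: "2 * sqrt ((real p)\<^sup>2 - real (p + 2 * k) - 1) < real p + 2 * real k * cos (2 * pi / real p)"
  obtains T where "symmetric_subset T" "\<one> \<in> T" "card T = p + 2 * k" "\<not> ramanujan G (carrier G - T)"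
proof -
  obtain \<psi> T where psi: "\<psi> \<in> characters G" "\<psi> \<noteq> trivial_character G"
    and T: "symmetric_subset T" "\<one> \<in> T" "card T = p + 2 * k"
    and sum: "(\<Sum>x\<in>T. \<psi> x) = of_real (real p + 2 * real k * cos (2 * pi / real p))"
    using exists_character_sum_eq[OF p k] .
  have "order G > 1" using one_less_power[OF prime_gt_1_nat[OF p(1)], of 2] p(2) by simp
  moreover have "cmod (\<Sum>x\<in>T. \<psi> x) > 2 * sqrt (real (order G) - real (card T) - 1)"
    unfolding sum norm_of_real T(3) using gt p(2) by simp
  ultimately have "\<not> ramanujan G (carrier G - T)"
    using psi ramanujan_complement_iff[OF _ T(1)] by (meson not_le)
  with T show thesis by (rule that)
qed

lemma ramanujan_prime_square:
  assumes p: "prime p" "order G = p\<^sup>2" and nc: "\<not> cyclic_group G"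
    and T: "symmetric_subset T" "\<one> \<in> T"
    and 1: "(real p + (real (card T) - real p) * cos (2 * pi / real p)) \<le> 2 * sqrt ((real p)\<^sup>2 - real (card T) - 1)"
    and 2: "(real (card T) - 1) * cos (pi / real p) - 1 \<le> 2 * sqrt ((real p)\<^sup>2 - real (card T) - 1)"
  shows "ramanujan G (carrier G - T)"
proof -
  have "order G > 1" using one_less_power[OF prime_gt_1_nat[OF p(1)], of 2] p(2) by simp
  moreover have "cmod (\<Sum>x\<in>T. \<psi> x) \<le> 2 * sqrt (real (order G) - real (card T) - 1)"
    if "\<psi> \<in> characters G" "\<psi> \<noteq> trivial_character G" for \<psi>
    using norm_sum_character_le[OF p nc that T] 1 2 p(2) by simp
  ultimately show ?thesis using ramanujan_complement_iff[OF _ T(1)] by blast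
qed

text \<open>Here \<open>p + 2 * k = 2 * p - 1\<close> is the size \<open>l_zero G + 2\<close>. The
  Ramanujan bound is \<open>2 * sqrt ((p - 1)\<^sup>2 - 1) < 2 * (p - 1)\<close>, so it is violated
  once \<open>(p - 1) * (1 - cos (2 * pi / p)) \<le> 1\<close>.\<close>

lemma ordinary_prime_square:
  assumes p: "prime p" "order G = p\<^sup>2" and p19: "p \<ge> 19"
  shows "ordinary G"
proof -
  have oddp: "odd p" using p(2) odd_order by simp
  define k where "k = (p - 1) div 2"
  have k: "2 * k = p - 1" using oddp by (simp add: k_def)
  have kp: "k \<le> p" using k by linarith
  have rk: "2 * real k = real p - 1" "real (p + 2 * k) = 2 * real p - 1" using k p19 by linarith+
  let ?c = "cos (2 * pi / real p)"
  have P: "real p \<ge> 19" using p19 by simp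
  \<comment> \<open>With the quadratic cosine bound the requirement reads
    \<open>3969 / 200 * (p - 1) \<le> p\<^sup>2\<close>, where 3969/200 is half the square of 63/10.
    This product has a root at 19 and differs from the required quadratic only in a larger constant
    term than is needed.\<close>
  have "0 \<le> (real p - 19) * (200 * real p - 169)" using P by (intro mult_nonneg_nonneg) auto
  also have "\<dots> = 200 * (real p)\<^sup>2 - 3969 * real p + 3211" by (simp add: power2_eq_square algebra_simps)
  finally have "3969 / 200 * (real p - 1) \<le> (real p)\<^sup>2" by simp
  then have "(63 / 10)\<^sup>2 / 2 * (real p - 1) \<le> (real p)\<^sup>2"
    by (simp add: power2_eq_square[of "63 / 10"])
  define d where "d = (63 / 10 / real p)\<^sup>2 / 2"
  have "(real p - 1) * d \<le> 1"
    using \<open>(63 / 10)\<^sup>2 / 2 * (real p - 1) \<le> (real p)\<^sup>2\<close> P by (simp add: d_def field_simps)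
  then have "real p - 2 \<le> (real p - 1) * (1 - d)" by (simp add: right_diff_distrib)
  also have "\<dots> \<le> (real p - 1) * ?c"
    using P cos_2pi_div_ge[of p] unfolding d_def by (intro mult_left_mono) auto
  finally have le: "2 * (real p - 1) \<le> real p + (real p - 1) * ?c"
    by (simp add: left_diff_distrib right_diff_distrib)
  have "sqrt ((real p)\<^sup>2 - 2 * real p) < sqrt ((real p - 1)\<^sup>2)"
    by (intro real_sqrt_less_mono) (simp add: power2_eq_square algebra_simps)
  then have "2 * sqrt ((real p)\<^sup>2 - 2 * real p) < 2 * (real p - 1)" using P by simp
  moreover have "(real p)\<^sup>2 - real (p + 2 * k) - 1 = (real p)\<^sup>2 - 2 * real p" using rk by simp
  ultimately have gt: "2 * sqrt ((real p)\<^sup>2 - real (p + 2 * k) - 1) < real p + 2 * real k * ?c"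
    using le unfolding rk(1) by (simp only: less_le_trans)
  obtain T where T: "symmetric_subset T" "\<one> \<in> T" "card T = p + 2 * k" "\<not> ramanujan G (carrier G - T)"
    using not_ramanujan_prime_square[OF p kp gt] .
  define l where "l = 2 * p - 3"
  have l: "int l = l_zero G" using l_zero_square[OF p(2)] p19 by (simp add: l_def)
  have "19 * p \<le> order G" unfolding p(2) power2_eq_square using p19 by (intro mult_right_mono) auto
  moreover from this have "order G \<ge> 9" using p19 by linarith
  ultimately have "l_hat G = int l"
    using T k p19 l ramanujan_up_to_l_zero by (intro l_hat_eq[of l T]) (auto simp: l_def)
  then show ?thesis using l by (simp add: ordinary_def)
qed

lemma ramanujan_prime_square_l_zero_plus_2:
  assumes p: "prime p" "order G = p\<^sup>2" "p \<in> {3, 5, 7, 11, 13, 17}" and nc: "\<not> cyclic_group G"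
    and T: "symmetric_subset T" "\<one> \<in> T" "card T = 2 * p - 1"
  shows "ramanujan G (carrier G - T)"
proof (rule ramanujan_prime_square[OF p(1,2) nc T(1,2)])
  have p3: "p \<ge> 3" using p(3) by auto
  have cT: "real (card T) = 2 * real p - 1" using T(3) p3 by linarith
  let ?b = "1 - (157 / 25 / real p)\<^sup>2 / 2 + (157 / 25 / real p) ^ 4 / 24"
  have "real p + (real (card T) - real p) * cos (2 * pi / real p) \<le> real p + (real p - 1) * ?b"
  proof -
    have "real (card T) - real p = real p - 1" using cT by simp
    then show ?thesis using cos_2pi_div_le[OF p3] p3 by (simp only:) (intro add_left_mono mult_left_mono, auto)
  qed
  \<comment> \<open>A finite check over the six primes, tightest at 17, where the two sides differ
    by less than 1/50.\<close>
  also have "\<dots> \<le> sqrt (4 * ((real p)\<^sup>2 - 2 * real p))"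
    using p(3) by (intro real_le_rsqrt) (auto simp: power2_eq_square eval_nat_numeral field_simps)
  also have "\<dots> = 2 * sqrt ((real p)\<^sup>2 - real (card T) - 1)"
    unfolding cT by (subst real_sqrt_mult) (simp add: algebra_simps)
  finally show "real p + (real (card T) - real p) * cos (2 * pi / real p) \<le> 2 * sqrt ((real p)\<^sup>2 - real (card T) - 1)" .
  have "(real (card T) - 1) * cos (pi / real p) - 1 \<le> 2 * real p - 3"
  proof -
    have eq: "real (card T) - 1 = 2 * real p - 2" using cT by simp
    have "(2 * real p - 2) * cos (pi / real p) \<le> (2 * real p - 2) * 1"
      using p3 by (intro mult_left_mono) auto
    then show ?thesis unfolding eq by (simp only: mult_1_right)
  qed
  \<comment> \<open>For negative sums the crude bound \<open>cos (pi / p) \<le> 1\<close> suffices: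
    after squaring, only \<open>9 \<le> 4 * p\<close> is needed.\<close>
  also have "\<dots> \<le> sqrt (4 * ((real p)\<^sup>2 - 2 * real p))"
    using p3 by (intro real_le_rsqrt) (auto simp: power2_eq_square algebra_simps)
  also have "\<dots> = 2 * sqrt ((real p)\<^sup>2 - real (card T) - 1)"
    unfolding cT by (subst real_sqrt_mult) (simp add: algebra_simps)
  finally show "(real (card T) - 1) * cos (pi / real p) - 1 \<le> 2 * sqrt ((real p)\<^sup>2 - real (card T) - 1)" .
qed

text \<open>Negative sums now need care: bounding \<open>cos (pi / 5)\<close> by 1 would give 9,
  above \<open>2 * sqrt 13\<close>. The estimate 82/100 gives exactly 36/5, which is just small
  enough.\<close>

lemma ramanujan_25_covalency_11:
  assumes ord: "order G = 5\<^sup>2" and nc: "\<not> cyclic_group G"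
    and T: "symmetric_subset T" "\<one> \<in> T" "card T = 11"
  shows "ramanujan G (carrier G - T)"
proof (rule ramanujan_prime_square[OF _ ord nc T(1,2)])
  have s: "36 / 5 \<le> 2 * sqrt ((real 5)\<^sup>2 - real (card T) - 1)"
  proof -
    have "18 / 5 \<le> sqrt 13" by (intro real_le_rsqrt) (simp add: power2_eq_square)
    then show ?thesis using T(3) by simp
  qed
  have "cos (2 * pi / real 5) \<le> 1 / 3"
    using cos_2pi_div_le[of 5] by (simp add: power2_eq_square eval_nat_numeral)
  then show "real 5 + (real (card T) - real 5) * cos (2 * pi / real 5) \<le> 2 * sqrt ((real 5)\<^sup>2 - real (card T) - 1)"
    using s T(3) by simp
  have "(pi / 5)\<^sup>2 \<le> 1\<^sup>2"
    using pi_approx(2) by (intro power_mono) auto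
  then have "cos (pi / 5) \<le> 1 - (157 / 250)\<^sup>2 / 2 + (157 / 250) ^ 4 / 24"
    using pi_approx(1) by (intro cos_le_quartic_mono) auto
  then have "cos (pi / 5) \<le> 82 / 100" by (simp add: power2_eq_square eval_nat_numeral)
  then show "(real (card T) - 1) * cos (pi / real 5) - 1 \<le> 2 * sqrt ((real 5)\<^sup>2 - real (card T) - 1)"
    using s T(3) by simp
qed simp

text \<open>Only the size \<open>2 * p - 1\<close> is new above \<open>l_zero G\<close>. The first
  conclusion is reused for exact values; the second covers all six primes, including 3, where only
  the inequality is derived.\<close>

lemma l_hat_ge_prime_square:
  assumes p: "prime p" "order G = p\<^sup>2" "p \<in> {3, 5, 7, 11, 13, 17}" and nc: "\<not> cyclic_group G"
  shows "\<And>S. cayley_subset G S \<Longrightarrow> covalency G S \<le> int (2 * p - 1) \<Longrightarrow> ramanujan G S"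
    and "l_zero G + 2 \<le> l_hat G"
proof -
  have p3: "p \<ge> 3" using p(3) by auto
  have "3 * p \<le> order G" unfolding p(2) power2_eq_square using p3 by (intro mult_right_mono) auto
  then have ord: "order G \<ge> 9" using p3 by linarith
  have l: "int (2 * p - 1) = l_zero G + 2" using l_zero_square[OF p(2)] p3 by simp
  show *: "ramanujan G S" if "cayley_subset G S" "covalency G S \<le> int (2 * p - 1)" for S
  proof (rule ramanujan_up_to[OF ord _ that])
    fix T assume T: "symmetric_subset T" "\<one> \<in> T" "l_zero G < int (card T)" "odd (card T)" "card T \<le> 2 * p - 1"
    then have "card T > 2 * p - 3" using l p3 by linarith
    then have "card T = 2 * p - 1" using T(4,5) p3 by presburger
    then show "ramanujan G (carrier G - T)"
      using ramanujan_prime_square_l_zero_plus_2[OF p nc T(1,2)] by blast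
  qed
  have "int (2 * p - 1) \<le> l_hat G"
    using \<open>3 * p \<le> order G\<close> p3 * by (intro l_hat_ge) auto
  then show "l_zero G + 2 \<le> l_hat G" using l by simp
qed

text \<open>The violating size is \<open>l_zero G + 4 = 2 * p + 1 = p + 2 * k\<close>; the quadratic
  lower bound for the cosine already exceeds the Ramanujan bound for these four primes.\<close>

lemma l_hat_prime_square:
  assumes p: "prime p" "order G = p\<^sup>2" "p \<in> {7, 11, 13, 17}" and nc: "\<not> cyclic_group G"
  shows "l_hat G = l_zero G + 2"
proof -
  have p7: "p \<ge> 7" using p(3) by auto
  have oddp: "odd p" using p(2) odd_order by simp
  define k where "k = (p + 1) div 2"
  have k: "2 * k = p + 1" using oddp by (simp add: k_def)
  have rk: "2 * real k = real p + 1" "real (p + 2 * k) = 2 * real p + 1" using k by linarith+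
  have "2 * sqrt ((real p)\<^sup>2 - real (p + 2 * k) - 1) = sqrt (4 * ((real p)\<^sup>2 - 2 * real p - 2))"
    unfolding rk by (subst real_sqrt_mult) (simp add: algebra_simps)
  also have "\<dots> < real p + (real p + 1) * (1 - (63 / 10 / real p)\<^sup>2 / 2)"
    using p(3) by (intro real_less_lsqrt) (auto simp: power2_eq_square field_simps)
  also have "\<dots> \<le> real p + (real p + 1) * cos (2 * pi / real p)"
    using cos_2pi_div_ge[of p] by (intro add_left_mono mult_left_mono) auto
  finally have gt: "2 * sqrt ((real p)\<^sup>2 - real (p + 2 * k) - 1) < real p + 2 * real k * cos (2 * pi / real p)"
    by (simp add: rk)
  obtain T where T: "symmetric_subset T" "\<one> \<in> T" "card T = p + 2 * k" "\<not> ramanujan G (carrier G - T)"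
    using not_ramanujan_prime_square[OF p(1,2) _ gt] k p7 by auto
  have "7 * p \<le> order G" unfolding p(2) power2_eq_square using p7 by (intro mult_right_mono) auto
  then have "l_hat G = int (2 * p - 1)"
    using T k p7 l_hat_ge_prime_square(1)[OF p(1,2) _ nc] p(3) by (intro l_hat_eq[of _ T]) auto
  then show ?thesis using l_zero_square[OF p(2)] p7 by simp
qed

text \<open>The sizes 9 and 11 above \<open>l_zero G = 7\<close> pass; size
  \<open>13 = 5 + 2 * 4\<close> fails, using four elements from each of the two cosets nearest the
  kernel.\<close>

lemma l_hat_25:
  assumes ord: "order G = 5\<^sup>2" and nc: "\<not> cyclic_group G"
  shows "l_hat G = l_zero G + 4"
proof -
  have p5: "prime (5::nat)" by simp
  have l0: "l_zero G = 7" using l_zero_square[OF ord] by simp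
  have "2 * sqrt ((real 5)\<^sup>2 - real (5 + 2 * 4) - 1) = sqrt (4 * 11)"
    by (subst real_sqrt_mult) simp
  also have "\<dots> < 5 + 8 * (1 - (63 / 10 / real 5)\<^sup>2 / 2)"
    by (intro real_less_lsqrt) (auto simp: power2_eq_square)
  also have "\<dots> \<le> real 5 + 2 * real 4 * cos (2 * pi / real 5)"
    using cos_2pi_div_ge[of 5] by simp
  finally obtain T where T: "symmetric_subset T" "\<one> \<in> T" "card T = 5 + 2 * 4" "\<not> ramanujan G (carrier G - T)"
    by (rule not_ramanujan_prime_square[OF p5 ord, rotated]) auto
  have ram: "ramanujan G S" if S: "cayley_subset G S" "covalency G S \<le> int 11" for S
  proof (rule ramanujan_up_to[OF _ _ S])
    fix T assume T: "symmetric_subset T" "\<one> \<in> T" "l_zero G < int (card T)" "odd (card T)" "card T \<le> 11"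
    then have "card T > 7" using l0 by simp
    then have "card T = 2 * 5 - 1 \<or> card T = 11" using T(4,5) by presburger
    then show "ramanujan G (carrier G - T)"
      using ramanujan_prime_square_l_zero_plus_2[OF p5 ord _ nc T(1,2)]
        ramanujan_25_covalency_11[OF ord nc T(1,2)] by auto
  qed (use l0 ord in auto)
  have "l_hat G = int 11"
    using T ord ram by (intro l_hat_eq[of 11 T]) auto
  then show ?thesis using l0 by simp
qed

section \<open>Orders \<open>p\<^sup>2 * k\<close> with \<open>k > 1\<close>\<close>

lemma ordinary_if_not_prime_square:
  assumes p: "prime p" "order G = p\<^sup>2 * k" and k: "k \<noteq> 1"
  shows "ordinary G"
proof -
  have odd: "odd p" "odd k" using odd_order p(2) by auto
  have p3: "p \<ge> 3" using odd(1) prime_gt_1_nat[OF p(1)] by presburger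
  have k3: "k \<ge> 3" using odd(2) k by presburger
  have "9 * 3 \<le> p\<^sup>2 * k" using power_mono[OF p3, of 2] k3 by (intro mult_mono) auto
  then have ord: "order G > 9" using p(2) by simp
  note b = l_zero_bounds[OF less_imp_le[OF ord]]
  show ?thesis
  proof (cases "k \<ge> 5")
    case True
    \<comment> \<open>For \<open>q = p\<close> the kernel has \<open>p * k\<close> elements, and
      \<open>4 * k \<le> k\<^sup>2\<close> turns the bound \<open>4 * p\<^sup>2 * k\<close> on
      \<open>(l_zero G + 2)\<^sup>2\<close> into \<open>(p * k)\<^sup>2\<close>.\<close>
    have "4 * int k \<le> int k * int k" using True by (intro mult_right_mono) auto
    then have "(int p)\<^sup>2 * (4 * int k) \<le> (int p)\<^sup>2 * (int k * int k)" by (intro mult_left_mono) auto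
    then have "(l_zero G + 2)\<^sup>2 \<le> (int p * int k)\<^sup>2"
      using b(3) p(2) by (simp add: power2_eq_square mult_ac)
    then have "l_zero G + 2 \<le> int p * int k" by (rule power2_le_imp_le) simp
    then have "(l_zero G + 2) * int p \<le> int p * int k * int p" by (intro mult_right_mono) auto
    then show ?thesis
      using p by (intro ordinary_if_large_kernel[OF ord p(1)]) (auto simp: power2_eq_square mult_ac)
  next
    case False
    then have k: "k = 3" using k3 odd(2) by presburger
    \<comment> \<open>For \<open>q = 3\<close> the kernel has \<open>p\<^sup>2\<close> elements. If
      \<open>p \<ge> 5\<close>, then \<open>12 * p\<^sup>2 \<le> p ^ 4\<close>; order 27 needs
      parity as well, since the odd number \<open>l_zero G + 2\<close> has square at most 108 and is
      therefore at most 9.\<close>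
    have "l_zero G + 2 \<le> (int p)\<^sup>2"
    proof (cases "p = 3")
      case True
      have "l_zero G + 2 < 11"
        using b(3) p(2) True k power_mono[of 11 "l_zero G + 2" 2] by (cases "l_zero G + 2 < 11") auto
      then have "l_zero G \<le> 7" using b(1) by presburger
      then show ?thesis using True by simp
    next
      case False
      then have "p \<ge> 5" using p3 odd(1) by presburger
      then have "25 \<le> p\<^sup>2" using power_mono[of 5 p 2] by simp
      then have "12 \<le> (int p)\<^sup>2" by (simp add: of_nat_power[symmetric] del: of_nat_power)
      then have "12 * (int p)\<^sup>2 \<le> (int p)\<^sup>2 * (int p)\<^sup>2" by (intro mult_right_mono) auto
      then have "(l_zero G + 2)\<^sup>2 \<le> ((int p)\<^sup>2)\<^sup>2"
        using b(3) p(2) k by (simp add: power2_eq_square)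
      then show ?thesis by (rule power2_le_imp_le) simp
    qed
    then show ?thesis
      using p(2) k by (intro ordinary_if_large_kernel[OF ord, of 3]) auto
  qed
qed

end

theorem theorem7p1:
  fixes G :: "('a, 'b) monoid_scheme"
  assumes "comm_group G"
    and "finite (carrier G)"
    and "odd (order G)"
    and "\<not> cyclic_group G"
  shows "(\<not> (\<exists>p::nat. prime p \<and> odd p \<and> 3 \<le> p \<and> p \<le> 17 \<and>
              G \<cong> integer_mod_group p \<times>\<times> integer_mod_group p)
            \<longrightarrow> ordinary G)
       \<and> (\<forall>p::nat. prime p \<and> odd p \<and> 3 \<le> p \<and> p \<le> 17 \<and>
              G \<cong> integer_mod_group p \<times>\<times> integer_mod_group p
            \<longrightarrow> exceptional G)
       \<and> (\<forall>p::nat. p \<in> {7, 11, 13, 17} \<and>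
              G \<cong> integer_mod_group p \<times>\<times> integer_mod_group p
            \<longrightarrow> l_hat G = l_zero G + 2)
       \<and> (G \<cong> integer_mod_group 5 \<times>\<times> integer_mod_group 5
            \<longrightarrow> l_hat G = l_zero G + 4)"
proof -
  interpret odd_abelian_group G
    using assms by (simp add: odd_abelian_group_def odd_abelian_group_axioms_def)
  have primes: "p \<in> {3, 5, 7, 11, 13, 17}" if "prime p" "odd p" "3 \<le> p" "p \<le> 17" for p :: nat
  proof -
    have "p \<noteq> 9" "p \<noteq> 15" using that(1) by (auto simp: prime_nat_iff dest: spec[of _ 3])
    then show ?thesis using that(2-4) by simp presburger
  qed
  have "ordinary G" if no: "\<not> (\<exists>p::nat. prime p \<and> odd p \<and> 3 \<le> p \<and> p \<le> 17 \<and>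
              G \<cong> integer_mod_group p \<times>\<times> integer_mod_group p)"
  proof -
    obtain p where p: "prime p" "p\<^sup>2 dvd order G"
      using not_cyclic_imp_prime_square_dvd[OF assms(2,4)] .
    then obtain k where k: "order G = p\<^sup>2 * k" by blast
    show ?thesis
    proof (cases "k = 1")
      case True
      then have ord: "order G = p\<^sup>2" using k by simp
      have oddp: "odd p" using ord assms(3) by simp
      have "p \<ge> 3" using oddp prime_gt_1_nat[OF p(1)] by presburger
      moreover have "\<not> p \<le> 17"
        using no iso_prime_square[OF assms(2,4) p(1) ord] p(1) oddp \<open>p \<ge> 3\<close> by blast
      ultimately have "p \<ge> 19" using oddp by presburger
      then show ?thesis using ordinary_prime_square[OF p(1) ord] by blast
    next
      case False
      then show ?thesis using ordinary_if_not_prime_square[OF p(1) k] by blast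
    qed
  qed
  moreover have "exceptional G" if "prime p" "odd p" "3 \<le> p" "p \<le> 17"
    "G \<cong> integer_mod_group p \<times>\<times> integer_mod_group p" for p :: nat
    unfolding exceptional_def
    using l_hat_ge_prime_square(2)[OF that(1) order_eq_if_iso_prime_square[OF that(5)] primes[OF that(1-4)] assms(4)] that(3)
    by simp
  moreover have "l_hat G = l_zero G + 2" if "p \<in> {7, 11, 13, 17}"
    "G \<cong> integer_mod_group p \<times>\<times> integer_mod_group p" for p :: nat
  proof -
    have "prime p" "p > 0" using that(1) by auto
    then show ?thesis
      using l_hat_prime_square[OF _ order_eq_if_iso_prime_square[OF that(2)] that(1) assms(4)] by blast
  qed
  moreover have "l_hat G = l_zero G + 4" if "G \<cong> integer_mod_group 5 \<times>\<times> integer_mod_group 5"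
    using l_hat_25[OF order_eq_if_iso_prime_square[OF that] assms(4)] by simp
  ultimately show ?thesis by blast
qed

end
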